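(* Let $1\le n\le m$, let $(M,\tau)$ be a tracial von Neumann algebra generated by self-adjoint elements $y_1,\dots,y_m$, i.e. $M=W^*(y_1,\dots,y_m)$, and let $y=y^*\in\operatorname{Alg}(y_1,\dots,y_n)\subset M$ be a non-constant polynomial in $y_1,\dots,y_n$. Assume that there exists a dual system to $y_1,\dots,y_m$, i.e. operators $R_j\in B(L^2(M))$, $1\le j\le m$, such that $[R_j,y_k]=\delta_{j=k}P_1$ for all $1\le j,k\le m$, where $P_1$ is the orthogonal projection onto $\mathbb{C}1\subset L^2(M)$. Then the spectral measure of $y$ is not singular with respect to Lebesgue measure.
   Context: A tracial von Neumann algebra ($W^*$-probability space) $(M,\tau)$ is a von Neumann algebra with a faithful normal tracial state $\tau$; $L^2(M)=L^2(M,\tau)$ and $M$ acts on it by left multiplication. $\operatorname{Alg}(y_1,\dots,y_n)$ is the unital algebra generated by $y_1,\dots,y_n$. $[A,B]=AB-BA$; $\delta_{j=k}$ is $1$ if $j=k$ and $0$ otherwise. The spectral measure of $y$ is the compactly supported probability measure $\mu$ on $\mathbb{R}$ with $\int t^k\,d\mu(t)=\tau(y^k)$ for all $k\ge0$. *)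

theory Defs
  imports "HOL-Analysis.Analysis" "HOL-Library.Poly_Mapping"
begin

section \<open>Complex Hilbert spaces\<close>

class scaleC =
  fixes scaleC :: "complex \<Rightarrow> 'a \<Rightarrow> 'a"  (infixr \<open>*\<^sub>C\<close> 75)

class complex_vector = scaleC + ab_group_add +
  assumes scaleC_add_right: "c *\<^sub>C (x + y) = c *\<^sub>C x + c *\<^sub>C y"
    and scaleC_add_left: "(c + d) *\<^sub>C x = c *\<^sub>C x + d *\<^sub>C x"
    and scaleC_scaleC: "c *\<^sub>C d *\<^sub>C x = (c * d) *\<^sub>C x"
    and scaleC_one: "1 *\<^sub>C x = x"

lemma scaleC_zero_right: "c *\<^sub>C 0 = (0 :: 'a::complex_vector)"
  using scaleC_add_right[of c 0 "0 :: 'a"] by simp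

lemma scaleC_minus_right: "c *\<^sub>C (- x) = - (c *\<^sub>C x)" for x :: "'a::complex_vector"
  using scaleC_add_right[of c x "- x"]
  by (simp add: scaleC_zero_right eq_neg_iff_add_eq_0 add.commute)

lemma scaleC_diff_right: "c *\<^sub>C (x - y) = c *\<^sub>C x - c *\<^sub>C y" for x y :: "'a::complex_vector"
  using scaleC_add_right[of c x "- y"] by (simp add: scaleC_minus_right)

text \<open>The norm and the topology are those of the underlying real inner product space. The complex
  inner product is conjugate-linear in its first argument.\<close>

class complex_inner = complex_vector + real_inner +
  fixes cinner :: "'a \<Rightarrow> 'a \<Rightarrow> complex"
  assumes scaleR_scaleC: "r *\<^sub>R x = complex_of_real r *\<^sub>C x"
    and cinner_commute: "cinner x y = cnj (cinner y x)"
    and cinner_add_right: "cinner x (y + z) = cinner x y + cinner x z"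
    and cinner_scaleC_right: "cinner x (c *\<^sub>C y) = c * cinner x y"
    and Re_cinner: "Re (cinner x y) = inner x y"

class chilbert_space = complex_inner + complete_space

lemma cinner_eq_inner:
  "cinner x y = Complex (inner x y) (inner (\<i> *\<^sub>C x) y)"
  for x y :: "'a::complex_inner"
proof -
  have "cinner (\<i> *\<^sub>C x) y = - \<i> * cinner x y"
    by (metis cinner_commute cinner_scaleC_right complex_cnj_cnj complex_cnj_i complex_cnj_mult)
  then have "inner (\<i> *\<^sub>C x) y = Im (cinner x y)"
    by (simp add: Re_cinner[symmetric])
  then show ?thesis
    by (simp add: complex_eq_iff Re_cinner)
qed

lemma inner_imaginary_left: "inner (\<i> *\<^sub>C x) y = - inner x (\<i> *\<^sub>C y)"
  for x y :: "'a::complex_inner"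
proof -
  have "cinner x (\<i> *\<^sub>C y) = \<i> * cinner x y" by (rule cinner_scaleC_right)
  then have "inner x (\<i> *\<^sub>C y) = - Im (cinner x y)"
    by (simp add: Re_cinner[symmetric])
  then show ?thesis by (simp add: cinner_eq_inner)
qed

lemma norm_scaleC: "norm (c *\<^sub>C x) = cmod c * norm x"
  for x :: "'a::complex_inner"
proof -
  have "cinner (c *\<^sub>C x) x = cnj c * cinner x x"
    by (metis cinner_commute cinner_scaleC_right complex_cnj_mult)
  then have "cinner (c *\<^sub>C x) (c *\<^sub>C x) = (c * cnj c) * cinner x x"
    by (simp add: cinner_scaleC_right)
  also have "c * cnj c = complex_of_real ((cmod c)\<^sup>2)"
    by (metis complex_norm_square of_real_power)
  finally have "Re (cinner (c *\<^sub>C x) (c *\<^sub>C x)) = (cmod c)\<^sup>2 * Re (cinner x x)"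
    by (simp only: Re_complex_of_real times_complex.sel Im_complex_of_real)
  then have "(norm (c *\<^sub>C x))\<^sup>2 = (cmod c * norm x)\<^sup>2"
    by (simp only: Re_cinner power2_norm_eq_inner power_mult_distrib)
  then show ?thesis
    by (rule power2_eq_imp_eq) simp_all
qed


section \<open>Bounded operators\<close>

typedef (overloaded) 'h cop =
    "{T :: 'h::chilbert_space \<Rightarrow> 'h. bounded_linear T \<and> (\<forall>c x. T (c *\<^sub>C x) = c *\<^sub>C T x)}"
  morphisms app Cop
proof
  show "(\<lambda>x. x) \<in> {T :: 'h \<Rightarrow> 'h. bounded_linear T \<and> (\<forall>c x. T (c *\<^sub>C x) = c *\<^sub>C T x)}"
    by (simp add: bounded_linear_ident)
qed

setup_lifting type_definition_cop

instantiation cop :: (chilbert_space) "{ring, monoid_mult, complex_vector}"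
begin

lift_definition zero_cop :: "'a cop" is "\<lambda>_. 0"
  by (simp add: bounded_linear_zero scaleC_zero_right)

lift_definition one_cop :: "'a cop" is "\<lambda>x. x"
  by (simp add: bounded_linear_ident)

lift_definition plus_cop :: "'a cop \<Rightarrow> 'a cop \<Rightarrow> 'a cop" is "\<lambda>S T x. S x + T x"
  by (simp add: bounded_linear_add scaleC_add_right)

lift_definition uminus_cop :: "'a cop \<Rightarrow> 'a cop" is "\<lambda>T x. - T x"
  by (simp add: bounded_linear_minus scaleC_minus_right)

lift_definition minus_cop :: "'a cop \<Rightarrow> 'a cop \<Rightarrow> 'a cop" is "\<lambda>S T x. S x - T x"
  by (simp add: bounded_linear_sub scaleC_diff_right)

lift_definition times_cop :: "'a cop \<Rightarrow> 'a cop \<Rightarrow> 'a cop" is "\<lambda>S T x. S (T x)"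
  by (simp add: bounded_linear_compose)

lift_definition scaleC_cop :: "complex \<Rightarrow> 'a cop \<Rightarrow> 'a cop" is "\<lambda>c T x. c *\<^sub>C T x"
proof -
  fix c :: complex and T :: "'a \<Rightarrow> 'a"
  assume T: "bounded_linear T \<and> (\<forall>c x. T (c *\<^sub>C x) = c *\<^sub>C T x)"
  have "bounded_linear (\<lambda>x :: 'a. c *\<^sub>C x)"
    by (rule bounded_linear_intro[where K = "cmod c"])
       (simp_all add: scaleC_add_right scaleR_scaleC scaleC_scaleC norm_scaleC mult.commute)
  with T show "bounded_linear (\<lambda>x. c *\<^sub>C T x) \<and> (\<forall>d x. c *\<^sub>C T (d *\<^sub>C x) = d *\<^sub>C c *\<^sub>C T x)"
    by (simp add: bounded_linear_compose scaleC_scaleC mult.commute)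
qed

instance
proof
  fix a b c :: "'a cop"
  show "(a + b) * c = a * c + b * c" by transfer simp
  show "a * (b + c) = a * b + a * c" by transfer (simp add: linear_simps)
qed (transfer; simp add: scaleC_add_right scaleC_add_left scaleC_scaleC scaleC_one
      algebra_simps)+

end

definition is_adjoint :: "'h::chilbert_space cop \<Rightarrow> 'h cop \<Rightarrow> bool" where
  "is_adjoint S T \<longleftrightarrow> (\<forall>x y. cinner (app S x) y = cinner x (app T y))"

definition cadjoint :: "'h::chilbert_space cop \<Rightarrow> 'h cop" where
  "cadjoint T = (THE S. is_adjoint S T)"

definition selfadjoint :: "'h::chilbert_space cop \<Rightarrow> bool" where
  "selfadjoint T \<longleftrightarrow> cadjoint T = T"

definition op_le :: "'h::chilbert_space cop \<Rightarrow> 'h cop \<Rightarrow> bool" where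
  "op_le S T \<longleftrightarrow> selfadjoint S \<and> selfadjoint T \<and>
     (\<forall>x. Re (cinner x (app S x)) \<le> Re (cinner x (app T x)))"

definition orthogonal_projection_onto :: "'h::chilbert_space cop \<Rightarrow> 'h set \<Rightarrow> bool" where
  "orthogonal_projection_onto P S \<longleftrightarrow>
     (\<forall>x. app P x \<in> S \<and> (\<forall>s\<in>S. cinner s (x - app P x) = 0))"

definition commutator :: "'a::ring \<Rightarrow> 'a \<Rightarrow> 'a" where
  "commutator A B = A * B - B * A"

text \<open>Existence of adjoints, so that the description in the definition of \<open>cadjoint\<close> is proper.\<close>

lemma riesz_real:
  fixes f :: "'a::{real_inner, complete_space} \<Rightarrow> real"
  assumes "bounded_linear f"
  shows "\<exists>t. \<forall>x. f x = inner t x"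
proof -
  interpret f: bounded_linear f by fact
  obtain K where K: "K \<ge> 0" "\<And>x. \<bar>f x\<bar> \<le> norm x * K"
    using f.nonneg_bounded by auto
  define J where "J x = inner x x / 2 - f x" for x
  have lb: "- K\<^sup>2 / 2 \<le> J x" for x
  proof -
    have "0 \<le> (norm x - K)\<^sup>2" by simp
    moreover have "f x \<le> norm x * K" using K(2)[of x] by simp
    ultimately show ?thesis
      by (simp add: J_def power2_norm_eq_inner[symmetric] power2_diff)
  qed
  define s where "s = Inf (range J)"
  have bdd: "bdd_below (range J)" using lb by (intro bdd_belowI2)
  have s_le: "s \<le> J x" for x unfolding s_def by (rule cINF_lower[OF bdd]) simp
  have "\<exists>x. J x < s + inverse (real (Suc n))" for n
  proof (rule ccontr)
    assume "\<not> ?thesis"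
    then have "s + inverse (real (Suc n)) \<le> s"
      by (subst (2) s_def, intro cINF_greatest) (auto simp: not_less)
    then show False by (simp del: of_nat_Suc)
  qed
  then obtain X where X: "\<And>n. J (X n) < s + inverse (real (Suc n))" by metis
  have par: "(norm (x - y))\<^sup>2 \<le> 4 * (J x + J y - 2 * s)" for x y
  proof -
    have "J x + J y - 2 * J ((1/2) *\<^sub>R (x + y)) = (norm (x - y))\<^sup>2 / 4"
      by (simp add: J_def f.scaleR f.add power2_norm_eq_inner inner_diff inner_add inner_commute
          field_simps)
    with s_le[of "(1/2) *\<^sub>R (x + y)"] show ?thesis by simp
  qed
  have "Cauchy X"
  proof (rule metric_CauchyI)
    fix e :: real assume e: "e > 0"
    obtain N where N: "inverse (real (Suc N)) < e\<^sup>2 / 8"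
      using reals_Archimedean[of "e\<^sup>2 / 8"] e by auto
    show "\<exists>M. \<forall>m\<ge>M. \<forall>n\<ge>M. dist (X m) (X n) < e"
    proof (intro exI allI impI)
      fix m n assume mn: "m \<ge> N" "n \<ge> N"
      have "inverse (real (Suc m)) \<le> inverse (real (Suc N))"
        "inverse (real (Suc n)) \<le> inverse (real (Suc N))"
        using mn by (simp_all add: field_simps)
      then have "(norm (X m - X n))\<^sup>2 < e\<^sup>2"
        using par[of "X m" "X n"] X[of m] X[of n] N
        by (simp only: distrib_left right_diff_distrib)
      then show "dist (X m) (X n) < e"
        using e by (simp add: dist_norm power2_less_imp_less)
    qed
  qed
  then obtain t where t: "X \<longlonglongrightarrow> t" using Cauchy_convergent convergent_def by blast
  have "(\<lambda>n. J (X n)) \<longlonglongrightarrow> J t"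
    unfolding J_def by (intro tendsto_intros f.tendsto t) simp
  moreover have "(\<lambda>n. s + inverse (real (Suc n))) \<longlonglongrightarrow> s + 0"
    by (intro tendsto_intros LIMSEQ_inverse_real_of_nat)
  ultimately have "J t \<le> s"
    using X by (intro LIMSEQ_le) (auto intro: less_imp_le)
  then have tmin: "J t \<le> J x" for x using s_le[of x] by simp
  have "f x = inner t x" for x
  proof (rule ccontr)
    assume ne: "f x \<noteq> inner t x"
    define d where "d = f x - inner t x"
    define q where "q = inner x x + 1"
    have q: "q > 0" using inner_ge_zero[of x] unfolding q_def by linarith
    have expand: "J (t + r *\<^sub>R x) = J t + (r\<^sup>2 * inner x x / 2 - r * d)" for r
    proof -
      have "inner (t + r *\<^sub>R x) (t + r *\<^sub>R x)
          = inner t t + 2 * (r * inner t x) + r\<^sup>2 * inner x x"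
        by (simp add: inner_add inner_commute[of x t] power2_eq_square distrib_left)
      moreover have "f (t + r *\<^sub>R x) = f t + r * f x" by (simp add: f.add f.scaleR)
      ultimately show ?thesis unfolding J_def d_def by (simp add: right_diff_distrib)
    qed
    have "(d / q)\<^sup>2 * inner x x \<le> (d / q)\<^sup>2 * q"
      by (rule mult_left_mono) (simp_all add: q_def)
    also have "(d / q)\<^sup>2 * q = (d / q) * d"
      using q by (simp add: power2_eq_square)
    finally have "(d / q)\<^sup>2 * inner x x \<le> (d / q) * d" .
    moreover have "(d / q) * d > 0"
    proof -
      have "d \<noteq> 0" using ne by (simp add: d_def)
      then have "d * d > 0" by (metis not_real_square_gt_zero)
      with q show ?thesis by simp
    qed
    moreover have "\<not> C \<le> B" if "A \<le> u" "u > 0" "B = C + (A / 2 - u)" for A B C u :: real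
      using that by linarith
    ultimately show False using tmin[of "t + (d / q) *\<^sub>R x"] expand[of "d / q"] by blast
  qed
  then show ?thesis by blast
qed

lemma cinner_ext: "(\<And>y. cinner x y = cinner z y) \<Longrightarrow> x = z"
  for x z :: "'a::complex_inner"
  by (metis Re_cinner vector_eq_rdot)

lemma is_adjoint_cadjoint: "is_adjoint (cadjoint T) T"
proof -
  have T: "bounded_linear (app T)" and Tc: "app T (c *\<^sub>C x) = c *\<^sub>C app T x" for c x
    using app[of T] by auto
  interpret T: bounded_linear "app T" by (rule T)
  have "\<exists>t. \<forall>y. inner x (app T y) = inner t y" for x
    by (rule riesz_real) (rule bounded_linear_compose[OF bounded_linear_inner_right T])
  then obtain S where S: "\<And>x y. inner (S x) y = inner x (app T y)" by metis
  have Sc: "S (c *\<^sub>C x) = c *\<^sub>C S x" for c x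
  proof -
    have i: "S (\<i> *\<^sub>C x) = \<i> *\<^sub>C S x" for x
      by (subst vector_eq_rdot[symmetric]) (simp add: S inner_imaginary_left Tc)
    have r: "S (r *\<^sub>R x) = r *\<^sub>R S x" for r x
      by (subst vector_eq_rdot[symmetric]) (simp add: S)
    have a: "S (x + y) = S x + S y" for x y
      by (subst vector_eq_rdot[symmetric]) (simp add: S inner_add)
    have eq: "c *\<^sub>C x = Re c *\<^sub>R x + Im c *\<^sub>R (\<i> *\<^sub>C x)" for x :: 'a
      by (simp add: scaleR_scaleC scaleC_scaleC scaleC_add_left[symmetric])
         (metis complex_eq mult.commute)
    have "S (c *\<^sub>C x) = S (Re c *\<^sub>R x + Im c *\<^sub>R (\<i> *\<^sub>C x))"
      by (rule arg_cong[OF eq])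
    also have "\<dots> = Re c *\<^sub>R S x + Im c *\<^sub>R (\<i> *\<^sub>C S x)"
      by (simp only: a r i)
    also have "\<dots> = c *\<^sub>C S x" by (rule eq[symmetric])
    finally show ?thesis .
  qed
  have "bounded_linear S"
  proof -
    obtain K where K: "K \<ge> 0" "\<And>x. norm (app T x) \<le> norm x * K"
      using T.nonneg_bounded by auto
    show ?thesis
    proof (rule bounded_linear_intro[where K = K])
      fix x
      have "(norm (S x))\<^sup>2 = inner x (app T (S x))"
        by (simp add: power2_norm_eq_inner S)
      also have "\<dots> \<le> norm x * norm (app T (S x))" by (rule norm_cauchy_schwarz)
      also have "\<dots> \<le> norm x * (norm (S x) * K)" by (simp add: mult_left_mono K)
      finally have "norm (S x) * norm (S x) \<le> norm (S x) * (norm x * K)"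
        by (simp add: power2_eq_square mult_ac)
      then show "norm (S x) \<le> norm x * K"
        using K(1) by (cases "norm (S x) = 0") auto
    qed (subst vector_eq_rdot[symmetric], simp add: S inner_add)+
  qed
  with Sc have "app (Cop S) = S" by (intro Cop_inverse) simp
  then obtain S' where S': "app S' = S" by blast
  have ex: "is_adjoint S' T"
    unfolding is_adjoint_def S'
  proof (intro allI)
    fix x y
    have "inner (\<i> *\<^sub>C S x) y = inner (\<i> *\<^sub>C x) (app T y)"
      using S[of "\<i> *\<^sub>C x" y] by (simp only: Sc)
    then show "cinner (S x) y = cinner x (app T y)"
      by (simp only: cinner_eq_inner S)
  qed
  moreover have "S'' = S'" if "is_adjoint S'' T" for S''
  proof -
    have "app S'' x = app S' x" for x
      using that ex unfolding is_adjoint_def by (intro cinner_ext) simp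
    then show ?thesis by (simp add: app_inject[symmetric] fun_eq_iff)
  qed
  ultimately show ?thesis unfolding cadjoint_def by (rule theI)
qed


section \<open>Tracial von Neumann algebras\<close>

definition commutant :: "'h::chilbert_space cop set \<Rightarrow> 'h cop set" where
  "commutant S = {T. \<forall>A\<in>S. T * A = A * T}"

definition von_neumann_algebra :: "'h::chilbert_space cop set \<Rightarrow> bool" where
  "von_neumann_algebra M \<longleftrightarrow> cadjoint ` M \<subseteq> M \<and> commutant (commutant M) = M"

definition W_star :: "'h::chilbert_space cop set \<Rightarrow> 'h cop set" where
  "W_star S = \<Inter>{N. von_neumann_algebra N \<and> S \<subseteq> N}"

definition state_on :: "'h::chilbert_space cop set \<Rightarrow> ('h cop \<Rightarrow> complex) \<Rightarrow> bool" where
  "state_on M \<tau> \<longleftrightarrow>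
     (\<forall>a\<in>M. \<forall>b\<in>M. \<tau> (a + b) = \<tau> a + \<tau> b) \<and>
     (\<forall>c. \<forall>a\<in>M. \<tau> (c *\<^sub>C a) = c * \<tau> a) \<and>
     (\<forall>a\<in>M. \<tau> (cadjoint a * a) \<in> \<real> \<and> 0 \<le> Re (\<tau> (cadjoint a * a))) \<and>
     \<tau> 1 = 1"

definition tracial_on :: "'h::chilbert_space cop set \<Rightarrow> ('h cop \<Rightarrow> complex) \<Rightarrow> bool" where
  "tracial_on M \<tau> \<longleftrightarrow> (\<forall>a\<in>M. \<forall>b\<in>M. \<tau> (a * b) = \<tau> (b * a))"

definition faithful_on :: "'h::chilbert_space cop set \<Rightarrow> ('h cop \<Rightarrow> complex) \<Rightarrow> bool" where
  "faithful_on M \<tau> \<longleftrightarrow> (\<forall>a\<in>M. \<tau> (cadjoint a * a) = 0 \<longrightarrow> a = 0)"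

text \<open>A state is normal if it preserves least upper bounds of upward directed sets (equivalently,
  of increasing nets) of self-adjoint elements.\<close>

definition normal_on :: "'h::chilbert_space cop set \<Rightarrow> ('h cop \<Rightarrow> complex) \<Rightarrow> bool" where
  "normal_on M \<tau> \<longleftrightarrow>
     (\<forall>D s. D \<noteq> {} \<and> D \<subseteq> {a\<in>M. selfadjoint a} \<and>
        (\<forall>a\<in>D. \<forall>b\<in>D. \<exists>c\<in>D. op_le a c \<and> op_le b c) \<and>
        s \<in> M \<and> selfadjoint s \<and> (\<forall>a\<in>D. op_le a s) \<and>
        (\<forall>u\<in>M. selfadjoint u \<and> (\<forall>a\<in>D. op_le a u) \<longrightarrow> op_le s u)
      \<longrightarrow> Re (\<tau> s) = (SUP a\<in>D. Re (\<tau> a)))"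

definition tracial_von_neumann_algebra ::
    "'h::chilbert_space cop set \<Rightarrow> ('h cop \<Rightarrow> complex) \<Rightarrow> bool" where
  "tracial_von_neumann_algebra M \<tau> \<longleftrightarrow> von_neumann_algebra M \<and> state_on M \<tau> \<and>
     tracial_on M \<tau> \<and> faithful_on M \<tau> \<and> normal_on M \<tau>"

text \<open>The Hilbert space \<open>'h\<close> is \<open>L\<^sup>2(M, \<tau>)\<close>, the completion of \<open>M\<close> for the inner product
  \<open>\<tau> (a\<^sup>* b)\<close>, with canonical map \<open>\<Lambda> : M \<rightarrow> L\<^sup>2(M, \<tau>)\<close>, and \<open>\<pi> a\<close> is left multiplication by \<open>a\<close>. These
  data exist for every tracial von Neumann algebra and are unique up to unitary equivalence.
  The vector \<open>\<Lambda> 1\<close> is the copy of \<open>1 \<in> M\<close> in \<open>L\<^sup>2(M, \<tau>)\<close>.\<close>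

definition L2_space ::
    "'k::chilbert_space cop set \<Rightarrow> ('k cop \<Rightarrow> complex) \<Rightarrow> ('k cop \<Rightarrow> 'h::chilbert_space) \<Rightarrow> bool" where
  "L2_space M \<tau> \<Lambda> \<longleftrightarrow>
     (\<forall>a\<in>M. \<forall>b\<in>M. \<Lambda> (a + b) = \<Lambda> a + \<Lambda> b) \<and>
     (\<forall>c. \<forall>a\<in>M. \<Lambda> (c *\<^sub>C a) = c *\<^sub>C \<Lambda> a) \<and>
     (\<forall>a\<in>M. \<forall>b\<in>M. cinner (\<Lambda> a) (\<Lambda> b) = \<tau> (cadjoint a * b)) \<and>
     closure (\<Lambda> ` M) = UNIV"

definition left_multiplication ::
    "'k::chilbert_space cop set \<Rightarrow> ('k cop \<Rightarrow> 'h::chilbert_space) \<Rightarrow> ('k cop \<Rightarrow> 'h cop) \<Rightarrow> bool" where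
  "left_multiplication M \<Lambda> \<pi> \<longleftrightarrow> (\<forall>a\<in>M. \<forall>b\<in>M. app (\<pi> a) (\<Lambda> b) = \<Lambda> (a * b))"


section \<open>Polynomials, dual systems, spectral measures\<close>

definition unital_subalgebra :: "'a::{ring, monoid_mult, complex_vector} set \<Rightarrow> bool" where
  "unital_subalgebra A \<longleftrightarrow> 1 \<in> A \<and>
     (\<forall>a\<in>A. \<forall>b\<in>A. a + b \<in> A \<and> a * b \<in> A) \<and> (\<forall>c. \<forall>a\<in>A. c *\<^sub>C a \<in> A)"

definition Alg :: "'a::{ring, monoid_mult, complex_vector} set \<Rightarrow> 'a set" where
  "Alg S = \<Inter>{A. unital_subalgebra A \<and> S \<subseteq> A}"

text \<open>A noncommutative polynomial in the indeterminates \<open>X\<^sub>1, X\<^sub>2, \<dots>\<close> is a finitely supported family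
  of coefficients indexed by words, the word \<open>[i\<^sub>1, \<dots>, i\<^sub>k]\<close> standing for the monomial
  \<open>X\<^bsub>i\<^sub>1\<^esub> \<cdots> X\<^bsub>i\<^sub>k\<^esub>\<close> and \<open>[]\<close> for the constant monomial.\<close>

type_synonym nc_poly = "nat list \<Rightarrow>\<^sub>0 complex"

definition nc_poly_in :: "nat \<Rightarrow> nc_poly \<Rightarrow> bool" where
  "nc_poly_in n p \<longleftrightarrow> Poly_Mapping.keys p \<subseteq> lists {1..n}"

definition nc_nonconstant :: "nc_poly \<Rightarrow> bool" where
  "nc_nonconstant p \<longleftrightarrow> (\<exists>w\<in>Poly_Mapping.keys p. w \<noteq> [])"

definition nc_eval :: "nc_poly \<Rightarrow> (nat \<Rightarrow> 'a::{ring, monoid_mult, complex_vector}) \<Rightarrow> 'a" where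
  "nc_eval p y = (\<Sum>w\<in>Poly_Mapping.keys p. Poly_Mapping.lookup p w *\<^sub>C prod_list (map y w))"

definition dual_system ::
    "nat \<Rightarrow> (nat \<Rightarrow> 'a::ring) \<Rightarrow> 'a \<Rightarrow> (nat \<Rightarrow> 'a) \<Rightarrow> bool" where
  "dual_system m Y P R \<longleftrightarrow>
     (\<forall>j\<in>{1..m}. \<forall>k\<in>{1..m}. commutator (R j) (Y k) = (if j = k then P else 0))"

definition is_spectral_measure ::
    "('h::chilbert_space cop \<Rightarrow> complex) \<Rightarrow> 'h cop \<Rightarrow> real measure \<Rightarrow> bool" where
  "is_spectral_measure \<tau> a \<mu> \<longleftrightarrow> sets \<mu> = sets borel \<and> emeasure \<mu> (space \<mu>) = 1 \<and>
     (\<exists>K. compact K \<and> emeasure \<mu> (- K) = 0) \<and>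
     (\<forall>k. complex_of_real (integral\<^sup>L \<mu> (\<lambda>t. t ^ k)) = \<tau> (a ^ k))"

definition singular_wrt_lebesgue :: "real measure \<Rightarrow> bool" where
  "singular_wrt_lebesgue \<mu> \<longleftrightarrow>
     (\<exists>A\<in>sets borel. emeasure lborel A = 0 \<and> emeasure \<mu> (- A) = 0)"

end

theory Submission
  imports Defs "HOL-Computational_Algebra.Polynomial"
begin

text \<open>The argument plays a trace identity against the singularity of \<open>\<mu>\<close>.

  Let \<open>Y\<close> be left multiplication by \<open>a\<close>, and suppose that a commutator \<open>[T, Y]\<close> has finite rank. If
  the trace of \<open>[T, Y]\<close> could be computed cyclically, it would vanish. For a singular spectral measure
  this is legitimate: the spectrum is covered, up to small \<open>\<mu>\<close>-measure, by finitely many disjoint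
  intervals of small total length. On the spectral subspace of an interval of length \<open>h\<close> the operator
  \<open>Y\<close> differs from a scalar by at most \<open>h\<close>, so that a unit vector in it contributes
  \<open>O(h \<parallel>T\<parallel>)\<close> to the trace of \<open>[T, Y]\<close>; and only boundedly many orthonormal vectors per interval
  matter, because the rank is finite. More generally \<open>Tr ([T, Y] X) = 0\<close> for every right
  multiplication \<open>X\<close>, since \<open>X\<close> commutes with \<open>Y\<close>. This is \<open>trace_commutator_singular\<close>.

  A dual system provides such \<open>T\<close>. As \<open>[R\<^sub>j, _]\<close> is a derivation, \<open>[R\<^sub>j, Y]\<close> is the free difference
  quotient \<open>\<partial>\<^sub>j p\<close> of the polynomial \<open>p\<close> with \<open>P\<^sub>1\<close> put in place of the tensor sign, so its trace
  against \<open>X\<close> is \<open>\<tau> (D\<^sub>j p \<cdot> x)\<close>, where \<open>D\<^sub>j\<close> is the cyclic derivative. Hence \<open>D\<^sub>j p\<close> vanishes at \<open>y\<close>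
  for every \<open>j\<close>. The operator \<open>R\<^sub>j Y\<close> gives in the same way that \<open>D\<^sub>j (p\<^sup>2)\<close> vanishes
  (\<open>cyclic_derivative_zero\<close>).

  The dual system also forces the \<open>y\<^sub>j\<close> to satisfy no polynomial relation (\<open>monomials_free\<close>): applying
  \<open>[R\<^sub>j, _]\<close> to a relation yields relations of smaller degree. So the cyclic derivatives of \<open>p\<close>
  and \<open>p\<^sup>2\<close> vanish already as formal polynomials. The Euler identity says that
  \<open>\<Sum>\<^sub>j X\<^sub>j D\<^sub>j\<close> replaces each word by the sum of its cyclic rotations, on which \<open>\<tau>\<close> is constant. So a
  polynomial whose cyclic derivatives vanish has the same trace as its constant term:
  \<open>\<tau> (a) = c\<close> and \<open>\<tau> (a\<^sup>2) = c\<^sup>2\<close> with \<open>c\<close> the constant term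
  of \<open>p\<close> (\<open>trace_of_cyclic_derivative_zero\<close>). Then \<open>\<tau> ((a - c)\<^sup>2) = 0\<close>, hence \<open>a = c\<close> by faithfulness,
  and freeness makes \<open>p\<close> constant.\<close>

section \<open>Complex Hilbert spaces\<close>

interpretation complex_vector: vector_space "scaleC :: complex \<Rightarrow> 'a \<Rightarrow> 'a::complex_vector"
  by unfold_locales (simp_all add: scaleC_add_right scaleC_add_left scaleC_scaleC scaleC_one)

lemma cinner_scaleC_left: "cinner (c *\<^sub>C x) y = cnj c * cinner x y"
  by (metis cinner_commute cinner_scaleC_right complex_cnj_mult)

lemma cinner_add_left: "cinner (x + y) z = cinner x z + cinner y z"
  by (metis cinner_commute cinner_add_right complex_cnj_add)

lemma cinner_zero_right [simp]: "cinner x 0 = 0"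
  using cinner_add_right[of x 0 0] by simp

lemma cinner_zero_left [simp]: "cinner 0 x = 0"
  using cinner_add_left[of 0 0 x] by simp

lemma cinner_diff_right: "cinner x (y - z) = cinner x y - cinner x z"
  using cinner_add_right[of x "y - z" z] by simp

lemma cinner_diff_left: "cinner (x - y) z = cinner x z - cinner y z"
  using cinner_add_left[of "x - y" y z] by simp

lemma cinner_sum_right: "cinner x (sum f I) = (\<Sum>i\<in>I. cinner x (f i))"
  by (induction I rule: infinite_finite_induct) (simp_all add: cinner_add_right)

lemma cinner_self: "cinner x x = complex_of_real ((norm x)\<^sup>2)"
proof -
  have "Im (cinner x x) = - Im (cinner x x)"
    using arg_cong[OF cinner_commute[of x x], of Im] by simp
  then show ?thesis
    by (simp add: complex_eq_iff Re_cinner power2_norm_eq_inner)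
qed

lemma cinner_cauchy_schwarz: "cmod (cinner x y) \<le> norm x * norm y"
proof (cases "cinner x y = 0")
  case False
  define c where "c = cnj (sgn (cinner x y))"
  have "cinner x (c *\<^sub>C y) = complex_of_real (cmod (cinner x y))"
    using False unfolding c_def cinner_scaleC_right
    by (simp add: sgn_eq complex_norm_square[symmetric] power2_eq_square mult.commute)
  then have "cmod (cinner x y) = inner x (c *\<^sub>C y)"
    by (metis Re_cinner Re_complex_of_real)
  also have "\<dots> \<le> norm x * norm (c *\<^sub>C y)" by (rule norm_cauchy_schwarz)
  also have "\<dots> = norm x * norm y"
    using False by (simp add: norm_scaleC c_def norm_sgn)
  finally show ?thesis .
qed simp

lemma bounded_linear_scaleC: "bounded_linear (\<lambda>x :: 'a::complex_inner. c *\<^sub>C x)"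
  by (rule bounded_linear_intro[where K = "cmod c"])
     (simp_all add: scaleC_add_right scaleR_scaleC scaleC_scaleC norm_scaleC mult.commute)

lemma tendsto_cinner:
  fixes f g :: "'b \<Rightarrow> 'a::complex_inner"
  assumes "(f \<longlongrightarrow> x) F" "(g \<longlongrightarrow> z) F"
  shows "((\<lambda>n. cinner (f n) (g n)) \<longlongrightarrow> cinner x z) F"
  unfolding cinner_eq_inner
  by (intro tendsto_Complex tendsto_inner assms
      bounded_linear.tendsto[OF bounded_linear_scaleC[of \<i>]])


section \<open>Bounded operators and von Neumann algebras\<close>

lemma bounded_linear_app: "bounded_linear (app T)"
  using app[of T] by simp

lemma app_scaleC: "app T (c *\<^sub>C x) = c *\<^sub>C app T x"
  using app[of T] by simp

lemma app_add: "app T (x + y) = app T x + app T y"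
  by (rule linear_simps[OF bounded_linear_app])

lemma app_diff: "app T (x - y) = app T x - app T y"
  by (rule linear_simps[OF bounded_linear_app])

lemma app_0: "app T 0 = 0"
  by (rule linear_simps[OF bounded_linear_app])

lemma app_sum: "app T (sum f I) = (\<Sum>i\<in>I. app T (f i))"
  by (induction I rule: infinite_finite_induct) (simp_all add: app_0 app_add)

lemma tendsto_app: "(f \<longlongrightarrow> x) F \<Longrightarrow> ((\<lambda>n. app T (f n)) \<longlongrightarrow> app T x) F"
  by (rule bounded_linear.tendsto[OF bounded_linear_app])

lemma app_bound: obtains C where "C \<ge> 0" "\<And>x. norm (app T x) \<le> C * norm x"
  using bounded_linear.nonneg_bounded[OF bounded_linear_app[of T]] by (metis mult.commute)

lemma cop_eqI: "(\<And>x. app S x = app T x) \<Longrightarrow> S = T"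
  by (simp add: app_inject[symmetric] fun_eq_iff)

lemmas app_simps = zero_cop.rep_eq one_cop.rep_eq plus_cop.rep_eq uminus_cop.rep_eq
  minus_cop.rep_eq times_cop.rep_eq scaleC_cop.rep_eq

lemma cop_scaleC_mult_left: "(c *\<^sub>C S) * T = c *\<^sub>C (S * T)" for S T :: "'h::chilbert_space cop"
  by (rule cop_eqI) (simp add: app_simps)

lemma cop_scaleC_mult_right: "S * (c *\<^sub>C T) = c *\<^sub>C (S * T)" for S T :: "'h::chilbert_space cop"
  by (rule cop_eqI) (simp add: app_simps app_scaleC)

lemma cinner_cadjoint_left: "cinner (app (cadjoint T) x) y = cinner x (app T y)"
  using is_adjoint_cadjoint[of T] unfolding is_adjoint_def by blast

lemma cinner_cadjoint_right: "cinner x (app (cadjoint T) y) = cinner (app T x) y"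
  by (metis cinner_cadjoint_left cinner_commute)

lemma cadjoint_unique: "(\<And>x y. cinner (app S x) y = cinner x (app T y)) \<Longrightarrow> cadjoint T = S"
  by (intro cop_eqI cinner_ext) (simp add: cinner_cadjoint_left)

lemma cadjoint_cadjoint [simp]: "cadjoint (cadjoint T) = T"
  by (rule cadjoint_unique) (simp add: cinner_cadjoint_right)

lemma cadjoint_mult: "cadjoint (S * T) = cadjoint T * cadjoint S"
  by (rule cadjoint_unique) (simp add: app_simps cinner_cadjoint_left)

lemma cadjoint_add: "cadjoint (S + T) = cadjoint S + cadjoint T"
  by (rule cadjoint_unique) (simp add: app_simps cinner_cadjoint_left cinner_add_left cinner_add_right)

lemma cadjoint_scaleC: "cadjoint (c *\<^sub>C T) = cnj c *\<^sub>C cadjoint T"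
  by (rule cadjoint_unique)
     (simp add: app_simps cinner_cadjoint_left cinner_scaleC_left cinner_scaleC_right)

lemma cadjoint_one [simp]: "cadjoint 1 = 1"
  by (rule cadjoint_unique) (simp add: app_simps)

lemma commutant_closed:
  shows "1 \<in> commutant S"
    and "A \<in> commutant S \<Longrightarrow> B \<in> commutant S \<Longrightarrow> A + B \<in> commutant S"
    and "A \<in> commutant S \<Longrightarrow> B \<in> commutant S \<Longrightarrow> A * B \<in> commutant S"
    and "A \<in> commutant S \<Longrightarrow> c *\<^sub>C A \<in> commutant S"
  unfolding commutant_def
  by (auto simp: algebra_simps cop_scaleC_mult_left cop_scaleC_mult_right) (metis mult.assoc)

lemma generators_in_W_star: "S \<subseteq> W_star S"
  by (auto simp: W_star_def)


section \<open>The standard representation of a tracial von Neumann algebra\<close>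

locale tracial_L2 =
  fixes M :: "'k::chilbert_space cop set" and \<tau> :: "'k cop \<Rightarrow> complex"
    and \<Lambda> :: "'k cop \<Rightarrow> 'h::chilbert_space" and \<pi> :: "'k cop \<Rightarrow> 'h cop"
  assumes tracial_vn: "tracial_von_neumann_algebra M \<tau>"
    and L2: "L2_space M \<tau> \<Lambda>"
    and left_mult: "left_multiplication M \<Lambda> \<pi>"
begin

lemma M_one [simp]: "1 \<in> M"
  and M_add [simp]: "A \<in> M \<Longrightarrow> B \<in> M \<Longrightarrow> A + B \<in> M"
  and M_mult [simp]: "A \<in> M \<Longrightarrow> B \<in> M \<Longrightarrow> A * B \<in> M"
  and M_scaleC [simp]: "A \<in> M \<Longrightarrow> c *\<^sub>C A \<in> M"
  and M_cadjoint [simp]: "A \<in> M \<Longrightarrow> cadjoint A \<in> M"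
proof -
  have M: "M = commutant (commutant M)" and adj: "cadjoint ` M \<subseteq> M"
    using tracial_vn unfolding tracial_von_neumann_algebra_def von_neumann_algebra_def by auto
  show "1 \<in> M" by (subst M) (rule commutant_closed)
  show "A + B \<in> M" if "A \<in> M" "B \<in> M"
    using that by (metis M commutant_closed(2))
  show "A * B \<in> M" if "A \<in> M" "B \<in> M"
    using that by (metis M commutant_closed(3))
  show "c *\<^sub>C A \<in> M" if "A \<in> M"
    using that by (metis M commutant_closed(4))
  show "cadjoint A \<in> M" if "A \<in> M"
    using that adj by auto
qed

lemma M_zero [simp]: "0 \<in> M"
  using M_scaleC[OF M_one, of 0] by simp

lemma M_diff [simp]: "A \<in> M \<Longrightarrow> B \<in> M \<Longrightarrow> A - B \<in> M"
  using M_add[OF _ M_scaleC[of B "-1"], of A] by simp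

lemma M_sum [simp]: "(\<And>i. i \<in> I \<Longrightarrow> f i \<in> M) \<Longrightarrow> sum f I \<in> M"
  by (induction I rule: infinite_finite_induct) auto

lemma M_power [simp]: "A \<in> M \<Longrightarrow> A ^ k \<in> M"
  by (induction k) auto

lemma \<tau>_add: "A \<in> M \<Longrightarrow> B \<in> M \<Longrightarrow> \<tau> (A + B) = \<tau> A + \<tau> B"
  and \<tau>_scaleC: "A \<in> M \<Longrightarrow> \<tau> (c *\<^sub>C A) = c * \<tau> A"
  and \<tau>_one: "\<tau> 1 = 1"
  and \<tau>_trace: "A \<in> M \<Longrightarrow> B \<in> M \<Longrightarrow> \<tau> (A * B) = \<tau> (B * A)"
  and \<tau>_faithful: "A \<in> M \<Longrightarrow> \<tau> (cadjoint A * A) = 0 \<Longrightarrow> A = 0"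
  using tracial_vn
  unfolding tracial_von_neumann_algebra_def state_on_def tracial_on_def faithful_on_def by auto

lemma \<tau>_zero: "\<tau> 0 = 0"
  using \<tau>_scaleC[OF M_one, of 0] by simp

lemma \<tau>_diff: "A \<in> M \<Longrightarrow> B \<in> M \<Longrightarrow> \<tau> (A - B) = \<tau> A - \<tau> B"
  using \<tau>_add[of "A - B" B] by simp

lemma \<tau>_sum: "(\<And>i. i \<in> I \<Longrightarrow> f i \<in> M) \<Longrightarrow> \<tau> (sum f I) = (\<Sum>i\<in>I. \<tau> (f i))"
  by (induction I rule: infinite_finite_induct) (auto simp: \<tau>_zero \<tau>_add)

lemma \<Lambda>_add: "A \<in> M \<Longrightarrow> B \<in> M \<Longrightarrow> \<Lambda> (A + B) = \<Lambda> A + \<Lambda> B"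
  and \<Lambda>_scaleC: "A \<in> M \<Longrightarrow> \<Lambda> (c *\<^sub>C A) = c *\<^sub>C \<Lambda> A"
  and cinner_\<Lambda>: "A \<in> M \<Longrightarrow> B \<in> M \<Longrightarrow> cinner (\<Lambda> A) (\<Lambda> B) = \<tau> (cadjoint A * B)"
  and \<Lambda>_dense: "closure (\<Lambda> ` M) = UNIV"
  using L2 unfolding L2_space_def by auto

lemma \<Lambda>_zero: "\<Lambda> 0 = 0"
  using \<Lambda>_scaleC[OF M_one, of 0] by simp

lemma \<Lambda>_diff: "A \<in> M \<Longrightarrow> B \<in> M \<Longrightarrow> \<Lambda> (A - B) = \<Lambda> A - \<Lambda> B"
  using \<Lambda>_add[of "A - B" B] by simp

lemma \<Lambda>_sum: "(\<And>i. i \<in> I \<Longrightarrow> f i \<in> M) \<Longrightarrow> \<Lambda> (sum f I) = (\<Sum>i\<in>I. \<Lambda> (f i))"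
  by (induction I rule: infinite_finite_induct) (auto simp: \<Lambda>_zero \<Lambda>_add)

lemma \<Lambda>_eq_0: "A \<in> M \<Longrightarrow> \<Lambda> A = 0 \<Longrightarrow> A = 0"
  by (metis cinner_\<Lambda> cinner_zero_left \<tau>_faithful)

lemma \<tau>_nondegenerate: "A \<in> M \<Longrightarrow> (\<And>B. B \<in> M \<Longrightarrow> \<tau> (A * B) = 0) \<Longrightarrow> A = 0"
  by (metis M_cadjoint \<tau>_faithful \<tau>_trace)

lemma \<pi>_\<Lambda>: "A \<in> M \<Longrightarrow> B \<in> M \<Longrightarrow> app (\<pi> A) (\<Lambda> B) = \<Lambda> (A * B)"
  using left_mult unfolding left_multiplication_def by auto

text \<open>Identities for \<open>\<pi>\<close> hold by definition on \<open>\<Lambda> ` M\<close> only; continuity carries them to all of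
  \<open>L\<^sup>2\<close>.\<close>

lemma eq_on_dense:
  fixes f g :: "'h \<Rightarrow> 'b::t2_space"
  assumes f: "continuous_on UNIV f" and g: "continuous_on UNIV g"
    and eq: "\<And>B. B \<in> M \<Longrightarrow> f (\<Lambda> B) = g (\<Lambda> B)"
  shows "f \<zeta> = g \<zeta>"
proof -
  have "\<zeta> \<in> closure (\<Lambda> ` M)" by (simp add: \<Lambda>_dense)
  then obtain s where s: "\<And>n. s n \<in> \<Lambda> ` M" "s \<longlonglongrightarrow> \<zeta>"
    by (meson closure_sequential)
  have lim: "(\<lambda>n. f (s n)) \<longlonglongrightarrow> f \<zeta>" "(\<lambda>n. g (s n)) \<longlonglongrightarrow> g \<zeta>"
    using f g s(2) by (auto simp: continuous_on_def intro: tendsto_compose)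
  moreover have "f (s n) = g (s n)" for n using s(1)[of n] eq by auto
  ultimately show ?thesis using LIMSEQ_unique by force
qed

lemma continuous_app [continuous_intros]:
  "continuous_on S f \<Longrightarrow> continuous_on S (\<lambda>x. app T (f x))"
  by (rule bounded_linear.continuous_on[OF bounded_linear_app])

lemma continuous_scaleC [continuous_intros]:
  "continuous_on S f \<Longrightarrow> continuous_on S (\<lambda>x. c *\<^sub>C (f x :: 'b::complex_inner))"
  by (rule bounded_linear.continuous_on[OF bounded_linear_scaleC])

lemma continuous_cinner [continuous_intros]:
  "continuous_on S f \<Longrightarrow> continuous_on S g \<Longrightarrow>
    continuous_on S (\<lambda>x. cinner (f x) (g x :: 'b::complex_inner))"
  by (auto simp: continuous_on_def intro: tendsto_cinner)

lemma \<pi>_mult: "A \<in> M \<Longrightarrow> B \<in> M \<Longrightarrow> app (\<pi> (A * B)) \<zeta> = app (\<pi> A) (app (\<pi> B) \<zeta>)"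
  by (rule eq_on_dense) (auto intro!: continuous_intros simp: \<pi>_\<Lambda> mult.assoc)

lemma \<pi>_one: "app (\<pi> 1) \<zeta> = \<zeta>"
  by (rule eq_on_dense) (auto intro!: continuous_intros simp: \<pi>_\<Lambda>)

lemma \<pi>_add: "A \<in> M \<Longrightarrow> B \<in> M \<Longrightarrow> app (\<pi> (A + B)) \<zeta> = app (\<pi> A) \<zeta> + app (\<pi> B) \<zeta>"
  by (rule eq_on_dense) (auto intro!: continuous_intros simp: \<pi>_\<Lambda> \<Lambda>_add distrib_right)

lemma \<pi>_scaleC: "A \<in> M \<Longrightarrow> app (\<pi> (c *\<^sub>C A)) \<zeta> = c *\<^sub>C app (\<pi> A) \<zeta>"
  by (rule eq_on_dense) (auto intro!: continuous_intros simp: \<pi>_\<Lambda> \<Lambda>_scaleC cop_scaleC_mult_left)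

lemma \<pi>_sum:
  "(\<And>i. i \<in> I \<Longrightarrow> f i \<in> M) \<Longrightarrow> app (\<pi> (sum f I)) \<zeta> = (\<Sum>i\<in>I. app (\<pi> (f i)) \<zeta>)"
proof (induction I rule: infinite_finite_induct)
  case (insert i I)
  then show ?case by (simp add: \<pi>_add)
qed (use \<pi>_scaleC[of 1 0 \<zeta>] in simp_all)

lemma \<pi>_cadjoint:
  assumes "A \<in> M"
  shows "cinner (app (\<pi> (cadjoint A)) \<zeta>) \<omega> = cinner \<zeta> (app (\<pi> A) \<omega>)"
proof (rule eq_on_dense[of "\<lambda>\<omega>. cinner (app (\<pi> (cadjoint A)) \<zeta>) \<omega>"])
  fix B assume B: "B \<in> M"
  show "cinner (app (\<pi> (cadjoint A)) \<zeta>) (\<Lambda> B) = cinner \<zeta> (app (\<pi> A) (\<Lambda> B))"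
    by (rule eq_on_dense[of "\<lambda>\<zeta>. cinner (app (\<pi> (cadjoint A)) \<zeta>) (\<Lambda> B)"])
       (use assms B in \<open>auto intro!: continuous_intros simp: \<pi>_\<Lambda> cinner_\<Lambda> cadjoint_mult mult.assoc\<close>)
qed (auto intro!: continuous_intros)

lemma norm_\<Lambda>_cadjoint: "A \<in> M \<Longrightarrow> norm (\<Lambda> (cadjoint A)) = norm (\<Lambda> A)"
  using cinner_\<Lambda>[of A A] cinner_\<Lambda>[of "cadjoint A" "cadjoint A"] \<tau>_trace[of A "cadjoint A"]
  unfolding cinner_self
  by (metis M_cadjoint cadjoint_cadjoint norm_ge_zero of_real_eq_iff power2_eq_imp_eq)

text \<open>By traciality the involution is isometric on \<open>L\<^sup>2\<close>, and it turns right multiplication by \<open>X\<close>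
  into left multiplication by \<open>X\<^sup>*\<close>, which is the bounded operator \<open>\<pi> (X\<^sup>*)\<close>.\<close>

lemma right_mult_bound:
  assumes "X \<in> M"
  obtains C where "C \<ge> 0" "\<And>A. A \<in> M \<Longrightarrow> norm (\<Lambda> (A * X)) \<le> C * norm (\<Lambda> A)"
proof -
  obtain C where C: "C \<ge> 0" "\<And>\<zeta>. norm (app (\<pi> (cadjoint X)) \<zeta>) \<le> C * norm \<zeta>"
    using app_bound by blast
  have "norm (\<Lambda> (A * X)) \<le> C * norm (\<Lambda> A)" if "A \<in> M" for A
    using that assms C(2)[of "\<Lambda> (cadjoint A)"] norm_\<Lambda>_cadjoint[of "A * X"]
    by (simp add: \<pi>_\<Lambda> norm_\<Lambda>_cadjoint cadjoint_mult)
  with C(1) show ?thesis using that by blast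
qed

lemma \<tau>_cadjoint: "A \<in> M \<Longrightarrow> \<tau> (cadjoint A) = cnj (\<tau> A)"
  using cinner_\<Lambda>[of A 1] cinner_\<Lambda>[of 1 A] cinner_commute[of "\<Lambda> A" "\<Lambda> 1"] by simp

end

section \<open>Bounded Borel functions of a self-adjoint element\<close>

definition op_poly :: "real poly \<Rightarrow> 'h::chilbert_space cop \<Rightarrow> 'h cop" where
  "op_poly p A = (\<Sum>i\<le>degree p. complex_of_real (coeff p i) *\<^sub>C A ^ i)"

lemma op_poly_altdef:
  assumes "degree p \<le> n"
  shows "op_poly p A = (\<Sum>i\<le>n. complex_of_real (coeff p i) *\<^sub>C A ^ i)"
  unfolding op_poly_def using assms
  by (intro sum.mono_neutral_left) (auto simp: not_le coeff_eq_0)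

lemma op_poly_0 [simp]: "op_poly 0 A = 0"
  by (simp add: op_poly_def)

lemma op_poly_pCons: "op_poly (pCons c p) A = complex_of_real c *\<^sub>C 1 + A * op_poly p A"
proof -
  have "op_poly (pCons c p) A
      = (\<Sum>i\<le>Suc (degree p). complex_of_real (coeff (pCons c p) i) *\<^sub>C A ^ i)"
    by (rule op_poly_altdef) (simp add: degree_pCons_le)
  also have "\<dots> = complex_of_real c *\<^sub>C 1 + A * op_poly p A"
    by (simp add: sum.atMost_Suc_shift op_poly_def sum_distrib_left cop_scaleC_mult_right
        del: sum.atMost_Suc)
  finally show ?thesis .
qed

lemma op_poly_add: "op_poly (p + q) A = op_poly p A + op_poly q A"
  by (subst (1 2 3) op_poly_altdef[of _ "max (degree p) (degree q)"])
     (auto simp: degree_add_le scaleC_add_left sum.distrib)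

lemma op_poly_smult: "op_poly (smult c p) A = complex_of_real c *\<^sub>C op_poly p A"
  by (subst (1 2) op_poly_altdef[of _ "degree p"])
     (auto simp: complex_vector.scale_sum_right degree_smult_le)

lemma op_poly_diff: "op_poly (p - q) A = op_poly p A - op_poly q A"
  using op_poly_add[of "p - q" q A] by simp

lemma op_poly_mult: "op_poly (p * q) A = op_poly p A * op_poly q A"
  by (induction p)
     (simp_all add: op_poly_pCons op_poly_add op_poly_smult distrib_right cop_scaleC_mult_left
       mult.assoc)

text \<open>The spectral projections of \<open>a\<close> are not constructed as operators. It suffices to have the
  vectors \<open>f(a) b\<close> with \<open>b \<in> M\<close>, which are limits of the vectors \<open>P\<^sub>n(a) b\<close> when the
  polynomials \<open>P\<^sub>n\<close> approximate \<open>f\<close>; the convergence is governed by \<open>\<mu>\<close> alone. The number \<open>r\<close>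
  only has to bound the support of \<open>\<mu>\<close>.\<close>

locale spectral_element = tracial_L2 M \<tau> \<Lambda> \<pi> + finite_measure \<mu>
  for M :: "'k::chilbert_space cop set" and \<tau> and \<Lambda> :: "'k cop \<Rightarrow> 'h::chilbert_space" and \<pi>
    and \<mu> :: "real measure" +
  fixes a :: "'k cop" and r :: real
  assumes a_M [simp]: "a \<in> M" and a_selfadjoint: "cadjoint a = a"
    and sets_\<mu> [measurable_cong, simp]: "sets \<mu> = sets borel"
    and support: "AE t in \<mu>. t \<in> {-r..r}"
    and moments: "complex_of_real (integral\<^sup>L \<mu> (\<lambda>t. t ^ k)) = \<tau> (a ^ k)"
begin

lemma integrable_bounded:
  assumes "f \<in> borel_measurable borel" "\<And>t. t \<in> {-r..r} \<Longrightarrow> \<bar>f t\<bar> \<le> C"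
  shows "integrable \<mu> (f :: real \<Rightarrow> real)"
proof (rule integrable_const_bound[where B = C])
  show "AE t in \<mu>. norm (f t) \<le> C"
    using support by eventually_elim (use assms(2) in auto)
qed (use assms(1) in auto)

lemma poly_measurable [measurable]: "poly (p :: real poly) \<in> borel_measurable borel"
  by (intro borel_measurable_continuous_onI continuous_intros)

lemma poly_bounded: obtains C where "\<And>t. t \<in> {-r..r} \<Longrightarrow> \<bar>poly p t\<bar> \<le> C"
proof -
  have "bounded (poly p ` {-r..r})"
    by (intro compact_imp_bounded compact_continuous_image continuous_intros) auto
  then obtain C where "\<forall>t\<in>{-r..r}. \<bar>poly p t\<bar> \<le> C" by (auto simp: bounded_iff)
  with that show ?thesis by blast
qed

lemma integrable_poly: "integrable \<mu> (poly p)"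
  using poly_bounded[of p] integrable_bounded[of "poly p"] by auto

lemma \<tau>_op_poly: "\<tau> (op_poly p a) = complex_of_real (\<integral>t. poly p t \<partial>\<mu>)"
proof -
  have int: "integrable \<mu> (\<lambda>t. t ^ i)" for i
    using integrable_poly[of "monom 1 i"] unfolding poly_monom by simp
  have "\<tau> (op_poly p a) = (\<Sum>i\<le>degree p. complex_of_real (coeff p i) * \<tau> (a ^ i))"
    unfolding op_poly_def by (subst \<tau>_sum) (auto simp: \<tau>_scaleC)
  also have "\<dots> = complex_of_real (\<Sum>i\<le>degree p. \<integral>t. coeff p i * t ^ i \<partial>\<mu>)"
    by (simp flip: moments)
  also have "(\<Sum>i\<le>degree p. \<integral>t. coeff p i * t ^ i \<partial>\<mu>) = (\<integral>t. poly p t \<partial>\<mu>)"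
    unfolding poly_altdef by (rule Bochner_Integration.integral_sum[symmetric]) (auto intro: int)
  finally show ?thesis .
qed

lemma op_poly_M [simp]: "op_poly p a \<in> M"
  by (simp add: op_poly_def)

lemma op_poly_commute: "op_poly p a * a = a * op_poly p a"
  using op_poly_mult[of p "[:0,1:]" a] op_poly_mult[of "[:0,1:]" p a]
  by (simp add: op_poly_pCons mult.commute)

lemma cadjoint_op_poly: "cadjoint (op_poly p a) = op_poly p a"
proof (induction p)
  case 0
  show ?case using cadjoint_scaleC[of 0 1] by simp
next
  case (pCons c p)
  then show ?case
    by (simp add: op_poly_pCons cadjoint_add cadjoint_scaleC cadjoint_mult a_selfadjoint
        op_poly_commute)
qed

lemma norm_op_poly: "(norm (\<Lambda> (op_poly p a)))\<^sup>2 = (\<integral>t. (poly p t)\<^sup>2 \<partial>\<mu>)"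
proof -
  have "complex_of_real ((norm (\<Lambda> (op_poly p a)))\<^sup>2) = \<tau> (op_poly (p * p) a)"
    using cinner_self[of "\<Lambda> (op_poly p a)"] by (simp add: cinner_\<Lambda> cadjoint_op_poly op_poly_mult)
  also have "\<dots> = complex_of_real (\<integral>t. (poly p t)\<^sup>2 \<partial>\<mu>)"
    by (simp add: \<tau>_op_poly power2_eq_square)
  finally show ?thesis by (simp only: of_real_eq_iff)
qed

text \<open>The \<open>L\<^sup>2\<close>-norm of \<open>p(a)\<close> is the norm of \<open>p\<close> in \<open>L\<^sup>2(\<mu>)\<close>, and right multiplication by \<open>b\<close> is
  bounded. So \<open>p \<mapsto> p(a) b\<close> is continuous from \<open>L\<^sup>2(\<mu>)\<close> to \<open>L\<^sup>2(M)\<close>.\<close>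

lemma norm_op_poly_mult:
  assumes "b \<in> M"
  obtains C where "C \<ge> 0"
    "\<And>p. norm (\<Lambda> (op_poly p a * b)) \<le> C * sqrt (\<integral>t. (poly p t)\<^sup>2 \<partial>\<mu>)"
proof -
  obtain C where C: "C \<ge> 0" "\<And>A. A \<in> M \<Longrightarrow> norm (\<Lambda> (A * b)) \<le> C * norm (\<Lambda> A)"
    using right_mult_bound[OF assms] by blast
  have "norm (\<Lambda> (op_poly p a * b)) \<le> C * sqrt (\<integral>t. (poly p t)\<^sup>2 \<partial>\<mu>)" for p
    using C(2)[of "op_poly p a"] by (simp flip: norm_op_poly)
  with C(1) show ?thesis using that by blast
qed

text \<open>Bounded pointwise convergence is stable under products, unlike convergence in \<open>L\<^sup>2(\<mu>)\<close>, and still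
  implies it by dominated convergence. Outside \<open>[-r, r]\<close> the function only has to be measurable.\<close>

definition poly_approx :: "(nat \<Rightarrow> real poly) \<Rightarrow> (real \<Rightarrow> real) \<Rightarrow> bool" where
  "poly_approx P f \<longleftrightarrow> f \<in> borel_measurable borel \<and>
     (\<exists>C. \<forall>n. \<forall>t\<in>{-r..r}. \<bar>poly (P n) t\<bar> \<le> C) \<and>
     (\<forall>t\<in>{-r..r}. (\<lambda>n. poly (P n) t) \<longlonglongrightarrow> f t)"

lemma poly_approx_poly: "poly_approx (\<lambda>_. p) (poly p)"
  using poly_bounded[of p] unfolding poly_approx_def by (metis poly_measurable tendsto_const)

lemma poly_approx_diff:
  assumes "poly_approx P f" "poly_approx Q g"
  shows "poly_approx (\<lambda>n. P n - Q n) (\<lambda>t. f t - g t)"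
proof -
  obtain B C where B: "\<And>n t. t \<in> {-r..r} \<Longrightarrow> \<bar>poly (P n) t\<bar> \<le> B"
    and C: "\<And>n t. t \<in> {-r..r} \<Longrightarrow> \<bar>poly (Q n) t\<bar> \<le> C"
    using assms unfolding poly_approx_def by metis
  have "\<bar>poly (P n - Q n) t\<bar> \<le> B + C" if "t \<in> {-r..r}" for n t
    using B[OF that, of n] C[OF that, of n] by simp
  then have "\<exists>C. \<forall>n. \<forall>t\<in>{-r..r}. \<bar>poly (P n - Q n) t\<bar> \<le> C" by blast
  with assms show ?thesis unfolding poly_approx_def by (auto intro!: tendsto_diff)
qed

lemma poly_approx_mult:
  assumes "poly_approx P f" "poly_approx Q g"
  shows "poly_approx (\<lambda>n. P n * Q n) (\<lambda>t. f t * g t)"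
proof -
  obtain B C where B: "\<And>n t. t \<in> {-r..r} \<Longrightarrow> \<bar>poly (P n) t\<bar> \<le> B"
    and C: "\<And>n t. t \<in> {-r..r} \<Longrightarrow> \<bar>poly (Q n) t\<bar> \<le> C"
    using assms unfolding poly_approx_def by metis
  have "\<bar>poly (P n * Q n) t\<bar> \<le> B * C" if "t \<in> {-r..r}" for n t
    using mult_mono[OF B[OF that, of n] C[OF that, of n]] B[OF that, of n]
    by (simp add: abs_mult)
  then have "\<exists>C. \<forall>n. \<forall>t\<in>{-r..r}. \<bar>poly (P n * Q n) t\<bar> \<le> C" by blast
  with assms show ?thesis unfolding poly_approx_def by (auto intro!: tendsto_mult)
qed

lemma poly_approx_integral:
  assumes "poly_approx P f"
  shows "(\<lambda>n. \<integral>t. poly (P n) t \<partial>\<mu>) \<longlonglongrightarrow> (\<integral>t. f t \<partial>\<mu>)"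
proof -
  obtain C where C: "\<And>n t. t \<in> {-r..r} \<Longrightarrow> \<bar>poly (P n) t\<bar> \<le> C"
    using assms unfolding poly_approx_def by metis
  show ?thesis
  proof (rule integral_dominated_convergence[where w = "\<lambda>_. C"])
    show "AE t in \<mu>. (\<lambda>n. poly (P n) t) \<longlonglongrightarrow> f t"
      using support by eventually_elim (use assms in \<open>auto simp: poly_approx_def\<close>)
    show "AE t in \<mu>. norm (poly (P n) t) \<le> C" for n
      using support by eventually_elim (use C in auto)
  qed (use assms in \<open>auto simp: poly_approx_def\<close>)
qed

lemma poly_approx_integral_square:
  assumes "poly_approx P f"
  shows "(\<lambda>n. \<integral>t. (poly (P n) t)\<^sup>2 \<partial>\<mu>) \<longlonglongrightarrow> (\<integral>t. (f t)\<^sup>2 \<partial>\<mu>)"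
  using poly_approx_integral[OF poly_approx_mult[OF assms assms]]
  by (simp add: power2_eq_square)

lemma poly_approx_Cauchy:
  assumes P: "poly_approx P f" and b: "b \<in> M"
  shows "Cauchy (\<lambda>n. \<Lambda> (op_poly (P n) a * b))"
proof -
  obtain C where C: "\<And>n t. t \<in> {-r..r} \<Longrightarrow> \<bar>poly (P n) t\<bar> \<le> C"
    using P unfolding poly_approx_def by metis
  have f [measurable]: "f \<in> borel_measurable borel"
    and lim: "\<And>t. t \<in> {-r..r} \<Longrightarrow> (\<lambda>n. poly (P n) t) \<longlonglongrightarrow> f t"
    using P unfolding poly_approx_def by auto
  have fC: "\<bar>f t\<bar> \<le> C" if "t \<in> {-r..r}" for t
    by (rule LIMSEQ_le_const2[OF tendsto_rabs[OF lim[OF that]]]) (use C that in auto)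
  define e where "e n = (\<integral>t. (poly (P n) t - f t)\<^sup>2 \<partial>\<mu>)" for n
  have bound: "(poly (P n) t - f t)\<^sup>2 \<le> (2 * C)\<^sup>2" if "t \<in> {-r..r}" for n t
    using C[OF that, of n] fC[OF that] by (intro power2_le_iff_abs_le[THEN iffD2]) linarith+
  have int: "integrable \<mu> (\<lambda>t. (poly (P n) t - f t)\<^sup>2)" for n
    by (rule integrable_bounded[where C = "(2 * C)\<^sup>2"]) (use bound in auto)
  have "(\<lambda>n. \<integral>t. (poly (P n) t - f t)\<^sup>2 \<partial>\<mu>) \<longlonglongrightarrow> (\<integral>t. 0 \<partial>\<mu>)"
  proof (rule integral_dominated_convergence[where w = "\<lambda>_. (2 * C)\<^sup>2"])
    show "AE t in \<mu>. (\<lambda>n. (poly (P n) t - f t)\<^sup>2) \<longlonglongrightarrow> 0"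
      using support
    proof eventually_elim
      case (elim t)
      have "(\<lambda>n. (poly (P n) t - f t)\<^sup>2) \<longlonglongrightarrow> (f t - f t)\<^sup>2"
        by (intro tendsto_intros lim elim)
      then show ?case by simp
    qed
    show "AE t in \<mu>. norm ((poly (P n) t - f t)\<^sup>2) \<le> (2 * C)\<^sup>2" for n
      using support by eventually_elim (use bound in auto)
  qed auto
  then have e0: "e \<longlonglongrightarrow> 0" by (simp add: e_def[abs_def])
  obtain D where D: "D \<ge> 0"
    "\<And>p. norm (\<Lambda> (op_poly p a * b)) \<le> D * sqrt (\<integral>t. (poly p t)\<^sup>2 \<partial>\<mu>)"
    using norm_op_poly_mult[OF b] by blast
  define s where "s n = D * sqrt (2 * e n)" for n
  have "s \<longlonglongrightarrow> D * sqrt (2 * 0)"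
    unfolding s_def by (intro tendsto_intros e0)
  then have s0: "s \<longlonglongrightarrow> 0" by simp
  \<comment> \<open>Compare \<open>P\<^sub>i\<close> and \<open>P\<^sub>j\<close> through \<open>f\<close>: \<open>(s + t)\<^sup>2 \<le> 2 s\<^sup>2 + 2 t\<^sup>2\<close>.\<close>
  have dist: "dist (\<Lambda> (op_poly (P i) a * b)) (\<Lambda> (op_poly (P j) a * b)) \<le> s i + s j" for i j
  proof -
    have "(\<integral>t. (poly (P i - P j) t)\<^sup>2 \<partial>\<mu>)
        \<le> (\<integral>t. 2 * (poly (P i) t - f t)\<^sup>2 + 2 * (poly (P j) t - f t)\<^sup>2 \<partial>\<mu>)"
    proof (rule integral_mono)
      have "poly ((P i - P j)\<^sup>2) = (\<lambda>t. (poly (P i - P j) t)\<^sup>2)"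
        by (rule ext) (rule poly_power)
      then show "integrable \<mu> (\<lambda>t. (poly (P i - P j) t)\<^sup>2)"
        using integrable_poly[of "(P i - P j)\<^sup>2"] by (simp only:)
      show "(poly (P i - P j) t)\<^sup>2 \<le> 2 * (poly (P i) t - f t)\<^sup>2 + 2 * (poly (P j) t - f t)\<^sup>2" for t
        using zero_le_power2[of "poly (P i) t + poly (P j) t - 2 * f t"]
        by (simp add: power2_eq_square algebra_simps)
    qed (use int in auto)
    also have "\<dots> = 2 * e i + 2 * e j"
      unfolding e_def using int by simp
    finally have le: "(\<integral>t. (poly (P i - P j) t)\<^sup>2 \<partial>\<mu>) \<le> 2 * e i + 2 * e j" .
    have "dist (\<Lambda> (op_poly (P i) a * b)) (\<Lambda> (op_poly (P j) a * b))
        = norm (\<Lambda> (op_poly (P i - P j) a * b))"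
      using b by (simp add: dist_norm op_poly_diff left_diff_distrib \<Lambda>_diff)
    also have "\<dots> \<le> D * sqrt (2 * e i + 2 * e j)"
      using D(2)[of "P i - P j"] le D(1)
      by (meson mult_left_mono order_trans real_sqrt_le_mono)
    also have "\<dots> \<le> s i + s j"
    proof -
      have "sqrt (2 * e i + 2 * e j) \<le> sqrt (2 * e i) + sqrt (2 * e j)"
        by (rule sqrt_add_le_add_sqrt) (simp_all add: e_def)
      from mult_left_mono[OF this D(1)] show ?thesis unfolding s_def distrib_left .
    qed
    finally show ?thesis .
  qed
  show ?thesis
  proof (rule metric_CauchyI)
    fix \<epsilon> :: real assume "\<epsilon> > 0"
    then obtain N where N: "\<And>n. n \<ge> N \<Longrightarrow> norm (s n - 0) < \<epsilon> / 2"
      using LIMSEQ_D[OF s0, of "\<epsilon> / 2"] by auto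
    show "\<exists>N. \<forall>i\<ge>N. \<forall>j\<ge>N. dist (\<Lambda> (op_poly (P i) a * b)) (\<Lambda> (op_poly (P j) a * b)) < \<epsilon>"
    proof (intro exI[of _ N] allI impI)
      fix i j assume "i \<ge> N" "j \<ge> N"
      then show "dist (\<Lambda> (op_poly (P i) a * b)) (\<Lambda> (op_poly (P j) a * b)) < \<epsilon>"
        using dist[of i j] N[of i] N[of j] by simp
    qed
  qed
qed

definition approximable :: "(real \<Rightarrow> real) \<Rightarrow> bool" where
  "approximable f \<longleftrightarrow> (\<exists>P. poly_approx P f)"

text \<open>The vector \<open>f(a) b\<close> of the functional calculus. The choice of the approximating sequence is
  immaterial by \<open>fun_vec_tendsto\<close> below.\<close>

definition fun_vec :: "(real \<Rightarrow> real) \<Rightarrow> 'k cop \<Rightarrow> 'h" where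
  "fun_vec f b = lim (\<lambda>n. \<Lambda> (op_poly ((SOME P. poly_approx P f) n) a * b))"

lemma norm_limit_le:
  assumes "poly_approx P f" "(\<lambda>n. \<Lambda> (op_poly (P n) a * b)) \<longlonglongrightarrow> \<zeta>"
    and "C \<ge> 0" "\<And>p. norm (\<Lambda> (op_poly p a * b)) \<le> C * sqrt (\<integral>t. (poly p t)\<^sup>2 \<partial>\<mu>)"
  shows "norm \<zeta> \<le> C * sqrt (\<integral>t. (f t)\<^sup>2 \<partial>\<mu>)"
proof (rule LIMSEQ_le)
  show "(\<lambda>n. norm (\<Lambda> (op_poly (P n) a * b))) \<longlonglongrightarrow> norm \<zeta>"
    by (intro tendsto_norm assms)
  show "(\<lambda>n. C * sqrt (\<integral>t. (poly (P n) t)\<^sup>2 \<partial>\<mu>)) \<longlonglongrightarrow> C * sqrt (\<integral>t. (f t)\<^sup>2 \<partial>\<mu>)"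
    by (intro tendsto_intros poly_approx_integral_square assms)
qed (use assms in blast)

text \<open>Two approximating sequences of \<open>f\<close> differ by an approximating sequence of \<open>0\<close>, and
  \<open>norm_limit_le\<close> forces the limit belonging to \<open>0\<close> to vanish.\<close>

lemma fun_vec_tendsto:
  assumes P: "poly_approx P f" and b: "b \<in> M"
  shows "(\<lambda>n. \<Lambda> (op_poly (P n) a * b)) \<longlonglongrightarrow> fun_vec f b"
proof -
  define Q where "Q = (SOME P. poly_approx P f)"
  have Q: "poly_approx Q f" unfolding Q_def using P by (rule someI[of "\<lambda>P. poly_approx P f"])
  have "convergent (\<lambda>n. \<Lambda> (op_poly (Q n) a * b))"
    using poly_approx_Cauchy[OF Q b] by (rule Cauchy_convergent)
  then have limQ: "(\<lambda>n. \<Lambda> (op_poly (Q n) a * b)) \<longlonglongrightarrow> fun_vec f b"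
    unfolding fun_vec_def Q_def by (simp add: convergent_LIMSEQ_iff)
  obtain \<zeta> where \<zeta>: "(\<lambda>n. \<Lambda> (op_poly (P n) a * b)) \<longlonglongrightarrow> \<zeta>"
    using Cauchy_convergent[OF poly_approx_Cauchy[OF P b]] by (auto simp: convergent_def)
  obtain C where C: "C \<ge> 0"
    "\<And>p. norm (\<Lambda> (op_poly p a * b)) \<le> C * sqrt (\<integral>t. (poly p t)\<^sup>2 \<partial>\<mu>)"
    using norm_op_poly_mult[OF b] by blast
  have "(\<lambda>n. \<Lambda> (op_poly (P n - Q n) a * b)) \<longlonglongrightarrow> \<zeta> - fun_vec f b"
    using tendsto_diff[OF \<zeta> limQ] b by (simp add: op_poly_diff left_diff_distrib \<Lambda>_diff)
  from norm_limit_le[OF poly_approx_diff[OF P Q] this C]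
  have "\<zeta> = fun_vec f b" by simp
  with \<zeta> show ?thesis by simp
qed

lemma norm_fun_vec:
  assumes "b \<in> M"
  obtains C where "C \<ge> 0"
    "\<And>f. approximable f \<Longrightarrow> norm (fun_vec f b) \<le> C * sqrt (\<integral>t. (f t)\<^sup>2 \<partial>\<mu>)"
proof -
  obtain C where C: "C \<ge> 0"
    "\<And>p. norm (\<Lambda> (op_poly p a * b)) \<le> C * sqrt (\<integral>t. (poly p t)\<^sup>2 \<partial>\<mu>)"
    using norm_op_poly_mult[OF assms] by blast
  show ?thesis
    by (rule that[OF C(1)])
       (use norm_limit_le[OF _ _ C] fun_vec_tendsto[OF _ assms] in \<open>auto simp: approximable_def\<close>)
qed

lemma fun_vec_poly: "b \<in> M \<Longrightarrow> fun_vec (poly p) b = \<Lambda> (op_poly p a * b)"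
  using fun_vec_tendsto[OF poly_approx_poly, of b p] by (simp add: LIMSEQ_const_iff)

lemma fun_vec_add_right:
  assumes "approximable f" "b \<in> M" "c \<in> M"
  shows "fun_vec f (b + c) = fun_vec f b + fun_vec f c"
proof -
  obtain P where P: "poly_approx P f" using assms(1) by (auto simp: approximable_def)
  have "(\<lambda>n. \<Lambda> (op_poly (P n) a * (b + c))) \<longlonglongrightarrow> fun_vec f b + fun_vec f c"
    using tendsto_add[OF fun_vec_tendsto[OF P assms(2)] fun_vec_tendsto[OF P assms(3)]] assms
    by (simp add: distrib_left \<Lambda>_add)
  then show ?thesis
    using fun_vec_tendsto[OF P M_add[OF assms(2,3)]] by (blast intro: LIMSEQ_unique)
qed

lemma fun_vec_scaleC_right:
  assumes "approximable f" "b \<in> M"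
  shows "fun_vec f (c *\<^sub>C b) = c *\<^sub>C fun_vec f b"
proof -
  obtain P where P: "poly_approx P f" using assms(1) by (auto simp: approximable_def)
  have "(\<lambda>n. \<Lambda> (op_poly (P n) a * (c *\<^sub>C b))) \<longlonglongrightarrow> c *\<^sub>C fun_vec f b"
    using bounded_linear.tendsto[OF bounded_linear_scaleC[of c] fun_vec_tendsto[OF P assms(2)]]
      assms
    by (simp add: cop_scaleC_mult_right \<Lambda>_scaleC)
  then show ?thesis
    using fun_vec_tendsto[OF P M_scaleC[OF assms(2), of c]] by (blast intro: LIMSEQ_unique)
qed

lemma fun_vec_diff_left:
  assumes "approximable f" "approximable g" "b \<in> M"
  shows "fun_vec (\<lambda>t. f t - g t) b = fun_vec f b - fun_vec g b"
proof -
  obtain P Q where P: "poly_approx P f" and Q: "poly_approx Q g"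
    using assms by (auto simp: approximable_def)
  have "(\<lambda>n. \<Lambda> (op_poly (P n - Q n) a * b)) \<longlonglongrightarrow> fun_vec f b - fun_vec g b"
    using tendsto_diff[OF fun_vec_tendsto[OF P assms(3)] fun_vec_tendsto[OF Q assms(3)]] assms
    by (simp add: op_poly_diff left_diff_distrib \<Lambda>_diff)
  then show ?thesis
    using fun_vec_tendsto[OF poly_approx_diff[OF P Q] assms(3)] by (blast intro: LIMSEQ_unique)
qed

text \<open>This is \<open>\<langle>f(a) b, g(a) c\<rangle> = \<langle>b, (f g)(a) c\<rangle>\<close>: real functions of \<open>a\<close> are self-adjoint and
  multiply pointwise.\<close>

lemma cinner_fun_vec:
  assumes "approximable f" "approximable g" "b \<in> M" "c \<in> M"
  shows "cinner (fun_vec f b) (fun_vec g c) = cinner (\<Lambda> b) (fun_vec (\<lambda>t. f t * g t) c)"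
proof -
  obtain P Q where P: "poly_approx P f" and Q: "poly_approx Q g"
    using assms by (auto simp: approximable_def)
  have "cinner (\<Lambda> (op_poly (P n) a * b)) (\<Lambda> (op_poly (Q n) a * c))
      = cinner (\<Lambda> b) (\<Lambda> (op_poly (P n * Q n) a * c))" for n
    using assms by (simp add: cinner_\<Lambda> cadjoint_mult cadjoint_op_poly op_poly_mult mult.assoc)
  moreover have "(\<lambda>n. cinner (\<Lambda> b) (\<Lambda> (op_poly (P n * Q n) a * c)))
      \<longlonglongrightarrow> cinner (\<Lambda> b) (fun_vec (\<lambda>t. f t * g t) c)"
    by (intro tendsto_cinner tendsto_const fun_vec_tendsto[OF poly_approx_mult[OF P Q]] assms)
  moreover have "(\<lambda>n. cinner (\<Lambda> (op_poly (P n) a * b)) (\<Lambda> (op_poly (Q n) a * c)))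
      \<longlonglongrightarrow> cinner (fun_vec f b) (fun_vec g c)"
    by (intro tendsto_cinner fun_vec_tendsto P Q assms)
  ultimately show ?thesis by (auto intro: LIMSEQ_unique)
qed

lemma \<pi>_fun_vec:
  assumes "approximable f" "b \<in> M"
  shows "app (\<pi> (op_poly p a)) (fun_vec f b) = fun_vec (\<lambda>t. poly p t * f t) b"
proof -
  obtain P where P: "poly_approx P f" using assms by (auto simp: approximable_def)
  have "(\<lambda>n. \<Lambda> (op_poly (p * P n) a * b)) \<longlonglongrightarrow> app (\<pi> (op_poly p a)) (fun_vec f b)"
    using tendsto_app[OF fun_vec_tendsto[OF P assms(2)], of "\<pi> (op_poly p a)"] assms(2)
    by (simp add: \<pi>_\<Lambda> op_poly_mult mult.assoc)
  then show ?thesis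
    using fun_vec_tendsto[OF poly_approx_mult[OF poly_approx_poly P] assms(2)]
    by (blast intro: LIMSEQ_unique)
qed

text \<open>Right multiplication by \<open>x\<close> commutes with \<open>f(a)\<close>, so its bound passes from \<open>M\<close> to the limits
  \<open>f(a) b\<close>.\<close>

lemma norm_fun_vec_mult:
  assumes "approximable f" "b \<in> M" "x \<in> M"
    and C: "\<And>A. A \<in> M \<Longrightarrow> norm (\<Lambda> (A * x)) \<le> C * norm (\<Lambda> A)"
  shows "norm (fun_vec f (b * x)) \<le> C * norm (fun_vec f b)"
proof -
  obtain P where P: "poly_approx P f" using assms by (auto simp: approximable_def)
  show ?thesis
  proof (rule LIMSEQ_le)
    show "(\<lambda>n. norm (\<Lambda> (op_poly (P n) a * (b * x)))) \<longlonglongrightarrow> norm (fun_vec f (b * x))"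
      by (intro tendsto_norm fun_vec_tendsto P M_mult assms)
    show "(\<lambda>n. C * norm (\<Lambda> (op_poly (P n) a * b))) \<longlonglongrightarrow> C * norm (fun_vec f b)"
      by (intro tendsto_intros fun_vec_tendsto P assms)
  qed (use C[of "op_poly (P _) a * b"] assms in \<open>auto simp: mult.assoc\<close>)
qed

lemma approximable_poly [simp]: "approximable (poly p)"
  using poly_approx_poly by (auto simp: approximable_def)

lemma approximable_diff [simp]:
  "approximable f \<Longrightarrow> approximable g \<Longrightarrow> approximable (\<lambda>t. f t - g t)"
  unfolding approximable_def by (blast intro: poly_approx_diff)

lemma approximable_mult [simp]:
  "approximable f \<Longrightarrow> approximable g \<Longrightarrow> approximable (\<lambda>t. f t * g t)"
  unfolding approximable_def by (blast intro: poly_approx_mult)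

text \<open>By Weierstrass, each \<open>c\<^sub>n\<close> may be replaced by a polynomial within \<open>1 / (n + 1)\<close> of it on
  \<open>[-r, r]\<close>; the values stay bounded and the limit is the same.\<close>

lemma approximable_continuous_limit:
  assumes c: "\<And>n. continuous_on {-r..r} (c n)" and B: "\<And>n t. t \<in> {-r..r} \<Longrightarrow> \<bar>c n t\<bar> \<le> B"
    and lim: "\<And>t. t \<in> {-r..r} \<Longrightarrow> (\<lambda>n. c n t) \<longlonglongrightarrow> f t" and f: "f \<in> borel_measurable borel"
  shows "approximable f"
proof -
  have "\<exists>p. \<forall>t\<in>{-r..r}. \<bar>c n t - poly p t\<bar> < inverse (real (Suc n))" for n
  proof -
    obtain g where g: "real_polynomial_function g"
      "\<And>t. t \<in> {-r..r} \<Longrightarrow> \<bar>c n t - g t\<bar> < inverse (real (Suc n))"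
      using Stone_Weierstrass_real_polynomial_function[OF compact_Icc c[of n],
          of "inverse (real (Suc n))"] by auto
    obtain k N where gk: "g = (\<lambda>t. \<Sum>i\<le>N. k i * t ^ i)"
      using g(1) real_polynomial_function_iff_sum by auto
    have "g t = poly (\<Sum>i\<le>N. monom (k i) i) t" for t
      by (simp add: gk poly_sum poly_monom)
    with g(2) show ?thesis by metis
  qed
  then obtain P where P: "\<And>n t. t \<in> {-r..r} \<Longrightarrow> \<bar>c n t - poly (P n) t\<bar> < inverse (real (Suc n))"
    by metis
  have "\<bar>poly (P n) t\<bar> \<le> B + 1" if "t \<in> {-r..r}" for n t
  proof -
    have "inverse (real (Suc n)) \<le> 1" by (simp add: field_simps)
    then show ?thesis using P[OF that, of n] B[OF that, of n] by linarith
  qed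
  moreover have "(\<lambda>n. poly (P n) t) \<longlonglongrightarrow> f t" if t: "t \<in> {-r..r}" for t
  proof -
    have "(\<lambda>n. c n t - poly (P n) t) \<longlonglongrightarrow> 0"
      by (rule Lim_null_comparison[OF _ LIMSEQ_inverse_real_of_nat])
         (use P[OF t] in \<open>auto intro!: always_eventually less_imp_le\<close>)
    from tendsto_diff[OF lim[OF t] this] show ?thesis by simp
  qed
  ultimately show ?thesis using f unfolding approximable_def poly_approx_def by blast
qed

lemma approximable_continuous:
  assumes "continuous_on UNIV f" shows "approximable f"
proof -
  have "bounded (f ` {-r..r})"
    by (intro compact_imp_bounded compact_continuous_image continuous_on_subset[OF assms]) auto
  then obtain B where "\<forall>t\<in>{-r..r}. \<bar>f t\<bar> \<le> B" by (auto simp: bounded_iff)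
  then show ?thesis
    by (intro approximable_continuous_limit[of "\<lambda>_. f" B])
       (use assms in \<open>auto intro: continuous_on_subset borel_measurable_continuous_onI\<close>)
qed

lemma approximable_lessThan: "approximable (indicator {..<s})"
proof (rule approximable_continuous_limit[of "\<lambda>n t. min 1 (max 0 (real n * (s - t)))" 1])
  \<comment> \<open>Ramps that vanish on \<open>{s..}\<close> and increase to the indicator as their slope grows.\<close>
  show "(\<lambda>n. min 1 (max 0 (real n * (s - t)))) \<longlonglongrightarrow> indicator {..<s} t" for t
  proof (cases "t < s")
    case True
    have "eventually (\<lambda>n. real n \<ge> inverse (s - t)) sequentially"
      using eventually_ge_at_top[of "nat \<lceil>inverse (s - t)\<rceil>"] by eventually_elim linarith
    then have "eventually (\<lambda>n. min 1 (max 0 (real n * (s - t))) = 1) sequentially"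
      by eventually_elim (use True in \<open>auto simp: field_simps\<close>)
    then show ?thesis using True by (simp add: tendsto_eventually)
  next
    case False
    then have "max 0 (real n * (s - t)) = 0" for n by (simp add: mult_nonneg_nonpos)
    then show ?thesis using False by simp
  qed
qed (auto intro!: continuous_intros)

lemma approximable_interval: "approximable (indicator {u..<v})"
proof (cases "u \<le> v")
  case True
  then have "indicator {u..<v} = (\<lambda>t. indicator {..<v} t - indicator {..<u} t :: real)"
    by (auto simp: fun_eq_iff split: split_indicator)
  then show ?thesis by (simp add: approximable_lessThan)
next
  case False
  then have "indicator {u..<v} = poly (0 :: real poly)"
    by (auto simp: fun_eq_iff)
  then show ?thesis by (metis approximable_poly)
qed

end

section \<open>Singular measures\<close>

text \<open>A null set that carries \<open>\<mu>\<close> has a compact part \<open>C\<close> of almost full \<open>\<mu>\<close>-measure and an open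
  neighbourhood \<open>U\<close> of small length. The cells of a fine enough grid that meet \<open>C\<close> stay inside \<open>U\<close>.
  A grid is used because its cells are disjoint and have a common length.\<close>

lemma singular_grid_cover:
  fixes \<mu> :: "real measure"
  assumes fin: "finite_measure \<mu>" and sets: "sets \<mu> = sets borel"
    and sing: "singular_wrt_lebesgue \<mu>" and \<epsilon>: "\<epsilon> > 0"
  obtains h :: real and G :: "int set" where "h > 0" "finite G" "real (card G) * h \<le> \<epsilon>"
    "measure \<mu> (- (\<Union>k\<in>G. {real_of_int k * h ..< (real_of_int k + 1) * h})) \<le> \<epsilon>"
proof -
  interpret finite_measure \<mu> by (rule fin)
  have space: "space \<mu> = UNIV" using sets_eq_imp_space_eq[OF sets] by simp
  obtain N where N: "N \<in> sets borel" "emeasure lborel N = 0" "emeasure \<mu> (- N) = 0"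
    using sing unfolding singular_wrt_lebesgue_def by auto
  obtain U where U: "open U" "N \<subseteq> U" "emeasure lborel (U - N) < ennreal \<epsilon>"
    using outer_regular_lborel[OF N(1), of "\<epsilon>"] \<epsilon> by auto
  have U_le: "emeasure lborel U \<le> ennreal \<epsilon>"
  proof -
    have "emeasure lborel U \<le> emeasure lborel (U - N) + emeasure lborel N"
      using U N by (subst emeasure_Un_null_set[symmetric])
        (auto simp: null_sets_def intro!: emeasure_mono)
    with U(3) N(2) show ?thesis by simp
  qed
  have "\<exists>C. C \<subseteq> N \<and> compact C \<and> measure \<mu> N < measure \<mu> C + \<epsilon>"
  proof (rule ccontr)
    assume no: "\<not> ?thesis"
    have "emeasure \<mu> N = (SUP C\<in>{C. C \<subseteq> N \<and> compact C}. emeasure \<mu> C)"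
      using N(1) by (intro inner_regular) (auto simp: sets)
    also have "\<dots> \<le> ennreal (measure \<mu> N - \<epsilon>)"
    proof (rule SUP_least)
      fix C assume "C \<in> {C. C \<subseteq> N \<and> compact C}"
      then show "emeasure \<mu> C \<le> ennreal (measure \<mu> N - \<epsilon>)"
        using no by (auto simp: emeasure_eq_measure intro!: ennreal_leI)
    qed
    finally have "measure \<mu> N \<le> max 0 (measure \<mu> N - \<epsilon>)"
      by (auto simp: emeasure_eq_measure ennreal_le_iff2 max_def)
    moreover have "measure \<mu> N < \<epsilon> \<Longrightarrow> False"
      using no by (auto dest!: spec[of _ "{}"])
    ultimately show False using \<epsilon> by (auto simp: max_def split: if_splits)
  qed
  then obtain C where C: "C \<subseteq> N" "compact C" "measure \<mu> N < measure \<mu> C + \<epsilon>" by blast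
  have Cb: "C \<in> sets borel" using C(2) by (simp add: borel_compact)
  have C_le: "measure \<mu> (- C) \<le> \<epsilon>"
  proof -
    have "measure \<mu> (- N) = 0" using N(3) by (simp add: measure_def)
    then have "measure \<mu> UNIV = measure \<mu> N"
      using finite_measure_compl[of N] N(1) by (simp add: sets space Compl_eq_Diff_UNIV)
    then show ?thesis
      using finite_measure_compl[of C] Cb C(3) by (simp add: sets space Compl_eq_Diff_UNIV)
  qed
  obtain d where d: "d > 0" "\<And>x. x \<in> C \<Longrightarrow> ball x d \<subseteq> U"
    using compact_subset_open_imp_ball_epsilon_subset[of C U] C U(1,2) by (metis UN_subset_iff subset_trans)
  \<comment> \<open>A cell of length \<open>h < d\<close> that meets \<open>C\<close> lies within distance \<open>d\<close> of a point of \<open>C\<close>, hence in \<open>U\<close>.\<close>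
  define h where "h = d / 2"
  have h: "h > 0" using d by (simp add: h_def)
  define I where "I k = {real_of_int k * h ..< (real_of_int k + 1) * h}" for k
  have I_iff: "x \<in> I k \<longleftrightarrow> k = \<lfloor>x / h\<rfloor>" for x k
    using h unfolding I_def by (auto simp: floor_eq_iff field_simps eq_commute[of k])
  define G where "G = (\<lambda>x. \<lfloor>x / h\<rfloor>) ` C"
  obtain B where B: "\<And>x. x \<in> C \<Longrightarrow> \<bar>x\<bar> \<le> B"
    using compact_imp_bounded[OF C(2)] by (auto simp: bounded_iff)
  have "- B / h \<le> x / h \<and> x / h \<le> B / h" if "x \<in> C" for x
    using B[OF that] h by (intro conjI divide_right_mono) auto
  then have "G \<subseteq> {\<lfloor>- B / h\<rfloor>..\<lfloor>B / h\<rfloor>}"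
    unfolding G_def by (auto intro!: floor_mono)
  then have finG: "finite G" by (rule finite_subset) simp
  have CI: "C \<subseteq> (\<Union>k\<in>G. I k)"
    unfolding G_def using I_iff by auto
  have IU: "(\<Union>k\<in>G. I k) \<subseteq> U"
  proof
    fix x assume "x \<in> (\<Union>k\<in>G. I k)"
    then obtain z where z: "z \<in> C" "x \<in> I \<lfloor>z / h\<rfloor>" unfolding G_def by auto
    then have "z \<in> I \<lfloor>z / h\<rfloor>" by (simp add: I_iff)
    with z(2) have "\<bar>x - z\<bar> < h"
      unfolding I_def by (auto simp: abs_less_iff algebra_simps)
    then have "x \<in> ball z d" using h by (simp add: h_def dist_real_def abs_minus_commute)
    then show "x \<in> U" using d(2)[OF z(1)] by blast
  qed
  have disj: "disjoint_family_on I G"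
    unfolding disjoint_family_on_def using I_iff by (auto simp: set_eq_iff)
  have "(\<Sum>k\<in>G. emeasure lborel (I k)) = emeasure lborel (\<Union>k\<in>G. I k)"
  proof (rule sum_emeasure)
    show "I ` G \<subseteq> sets lborel" by (auto simp: I_def)
  qed (rule disj finG)+
  also have "\<dots> \<le> emeasure lborel U"
    by (rule emeasure_mono) (use IU U(1) in auto)
  also have "\<dots> \<le> ennreal \<epsilon>" by (rule U_le)
  finally have "ennreal (real (card G) * h) \<le> ennreal \<epsilon>"
    using h by (simp add: I_def algebra_simps ennreal_mult ennreal_of_nat_eq_real_of_nat)
  then have "real (card G) * h \<le> \<epsilon>" using \<epsilon> by (simp add: ennreal_le_iff)
  moreover have "measure \<mu> (- (\<Union>k\<in>G. I k)) \<le> measure \<mu> (- C)"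
    by (rule finite_measure_mono) (use CI Cb in \<open>auto simp: sets I_def\<close>)
  ultimately show ?thesis
    using that[of h G] h finG C_le unfolding I_def by simp
qed

section \<open>The trace of a finite-rank commutator\<close>

context tracial_L2 begin

text \<open>The orthonormal vectors have to be images \<open>W d\<close> of elements \<open>d\<close> of \<open>M\<close>: later \<open>W d\<close> is paired with
  \<open>W (d x)\<close>, the result of multiplying it by \<open>x\<close> from the right.\<close>

lemma gram_schmidt:
  fixes W :: "'k cop \<Rightarrow> 'h"
  assumes add: "\<And>b c. b \<in> M \<Longrightarrow> c \<in> M \<Longrightarrow> W (b + c) = W b + W c"
    and scale: "\<And>b c. b \<in> M \<Longrightarrow> W (c *\<^sub>C b) = c *\<^sub>C W b"
    and B: "finite B" "B \<subseteq> M"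
  shows "\<exists>D. finite D \<and> D \<subseteq> M \<and> card D \<le> card B \<and>
     (\<forall>d\<in>D. \<forall>e\<in>D. cinner (W d) (W e) = (if d = e then 1 else 0)) \<and>
     (\<forall>b\<in>B. W b = (\<Sum>d\<in>D. cinner (W d) (W b) *\<^sub>C W d))"
  using B
proof (induction B)
  case empty
  show ?case by (intro exI[of _ "{}"]) simp
next
  case (insert b B)
  then obtain D where D: "finite D" "D \<subseteq> M" "card D \<le> card B"
    and on: "\<And>d e. d \<in> D \<Longrightarrow> e \<in> D \<Longrightarrow> cinner (W d) (W e) = (if d = e then 1 else 0)"
    and span: "\<And>b. b \<in> B \<Longrightarrow> W b = (\<Sum>d\<in>D. cinner (W d) (W b) *\<^sub>C W d)"
    by auto
  have bM: "b \<in> M" using insert by simp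
  have W0: "W 0 = 0" using scale[of 0 0] by simp
  have Wsum: "W (sum f I) = (\<Sum>i\<in>I. W (f i))" if "\<And>i. i \<in> I \<Longrightarrow> f i \<in> M" for f and I :: "'k cop set"
    using that by (induction I rule: infinite_finite_induct) (auto simp: W0 add)
  \<comment> \<open>Its image is the part of \<open>W b\<close> orthogonal to the vectors found so far, to be normalized unless it is \<open>0\<close>.\<close>
  define v where "v = b + (-1) *\<^sub>C (\<Sum>d\<in>D. cinner (W d) (W b) *\<^sub>C d)"
  have sM: "(\<Sum>d\<in>D. cinner (W d) (W b) *\<^sub>C d) \<in> M" using D(2) by (auto intro!: M_sum)
  have vM: "v \<in> M" unfolding v_def using bM sM by (intro M_add M_scaleC)
  have Wv: "W v = W b - (\<Sum>d\<in>D. cinner (W d) (W b) *\<^sub>C W d)"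
  proof -
    have "W v = W b + (-1) *\<^sub>C W (\<Sum>d\<in>D. cinner (W d) (W b) *\<^sub>C d)"
      unfolding v_def using bM sM by (simp only: add scale M_scaleC)
    also have "W (\<Sum>d\<in>D. cinner (W d) (W b) *\<^sub>C d) = (\<Sum>d\<in>D. cinner (W d) (W b) *\<^sub>C W d)"
      using D(2) by (subst Wsum) (auto simp: scale subset_iff intro!: sum.cong)
    finally show ?thesis by simp
  qed
  have orth: "cinner (W d) (W v) = 0" if "d \<in> D" for d
  proof -
    have "cinner (W d) (\<Sum>d\<in>D. cinner (W d) (W b) *\<^sub>C W d)
        = (\<Sum>e\<in>D. if e = d then cinner (W e) (W b) else 0)"
      unfolding cinner_sum_right by (intro sum.cong) (auto simp: cinner_scaleC_right on that)
    also have "\<dots> = cinner (W d) (W b)" using that D(1) by simp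
    finally show ?thesis by (simp add: Wv cinner_diff_right)
  qed
  show ?case
  proof (cases "W v = 0")
    case True
    then have "W b = (\<Sum>d\<in>D. cinner (W d) (W b) *\<^sub>C W d)" using Wv by simp
    then show ?thesis
      using D on span insert.hyps by (intro exI[of _ D]) auto
  next
    case False
    define n where "n = norm (W v)"
    have n: "n > 0" using False by (simp add: n_def)
    define e where "e = complex_of_real (1 / n) *\<^sub>C v"
    have eM: "e \<in> M" unfolding e_def using vM by simp
    have We: "W e = complex_of_real (1 / n) *\<^sub>C W v" unfolding e_def using vM by (rule scale)
    have Wv': "W v = complex_of_real n *\<^sub>C W e"
      using n by (simp add: We scaleC_scaleC scaleC_one)
    have ee: "cinner (W e) (W e) = 1"
    proof -
      have "norm (W e) = 1" using n by (simp add: We norm_scaleC norm_divide flip: n_def)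
      then show ?thesis by (simp add: cinner_self)
    qed
    have de: "cinner (W d) (W e) = 0" "cinner (W e) (W d) = 0" if "d \<in> D" for d
      using orth[OF that] cinner_commute[of "W e" "W d"]
      by (simp_all add: We cinner_scaleC_right)
    have eD: "e \<notin> D" using de(1)[of e] ee by auto
    have eb: "cinner (W e) (W b) = complex_of_real n"
    proof -
      have "W b = W v + (\<Sum>d\<in>D. cinner (W d) (W b) *\<^sub>C W d)" by (simp add: Wv)
      then have "cinner (W e) (W b) = cinner (W e) (W v)
          + (\<Sum>d\<in>D. cinner (W d) (W b) * cinner (W e) (W d))"
        by (metis (no_types, lifting) cinner_add_right cinner_sum_right cinner_scaleC_right sum.cong)
      also have "\<dots> = complex_of_real n"
        using de by (simp add: Wv' cinner_scaleC_right ee)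
      finally show ?thesis .
    qed
    have eB: "cinner (W e) (W c) = 0" if "c \<in> B" for c
      by (subst span[OF that]) (simp add: cinner_sum_right cinner_scaleC_right de)
    have "\<forall>c\<in>insert b B. W c = (\<Sum>d\<in>insert e D. cinner (W d) (W c) *\<^sub>C W d)"
      using D(1) eD eb eB span by (auto simp: Wv'[symmetric] Wv)
    moreover have "\<forall>d\<in>insert e D. \<forall>d'\<in>insert e D. cinner (W d) (W d') = (if d = d' then 1 else 0)"
      using on de ee eD by auto
    ultimately show ?thesis
      using D eD eM insert.hyps by (intro exI[of _ "insert e D"]) auto
  qed
qed

end

context spectral_element begin

lemma fun_vec_const: "b \<in> M \<Longrightarrow> fun_vec (\<lambda>_. 1) b = \<Lambda> b"
proof -
  assume "b \<in> M"
  moreover have "poly [:1:] = (\<lambda>_. 1 :: real)" by (rule ext) simp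
  ultimately show ?thesis
    using fun_vec_poly[of b "[:1:]"] by (simp add: op_poly_pCons scaleC_one)
qed

lemma approximable_const [simp]: "approximable (\<lambda>_. c)"
proof -
  have "poly [:c:] = (\<lambda>_. c)" by (rule ext) simp
  then show ?thesis using approximable_poly[of "[:c:]"] by (simp only:)
qed

lemma fun_vec_sum_right:
  assumes "approximable f" "\<And>i. i \<in> I \<Longrightarrow> g i \<in> M"
  shows "fun_vec f (sum g I) = (\<Sum>i\<in>I. fun_vec f (g i))"
  using assms(2)
proof (induction I rule: infinite_finite_induct)
  case (insert i I)
  then show ?case by (simp add: fun_vec_add_right assms(1))
qed (use fun_vec_scaleC_right[OF assms(1) M_zero, of 0] in simp_all)

lemma \<pi>_a_cinner: "cinner (app (\<pi> a) \<zeta>) \<omega> = cinner \<zeta> (app (\<pi> a) \<omega>)"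
  using \<pi>_cadjoint[OF a_M] by (simp add: a_selfadjoint)

text \<open>The operator \<open>1\<^sub>S(a)\<close> is an orthogonal projection since an indicator function is idempotent.\<close>

lemma fun_vec_projection:
  fixes S :: "real set"
  assumes "approximable (indicator S)" "b \<in> M" "c \<in> M"
  shows "cinner (fun_vec (indicator S) b) (\<Lambda> c)
    = cinner (fun_vec (indicator S) b) (fun_vec (indicator S) c)"
proof -
  have "cinner (fun_vec (indicator S) b) (fun_vec (\<lambda>_. 1) c)
    = cinner (fun_vec (indicator S) b) (fun_vec (indicator S) c)"
    using assms by (simp add: cinner_fun_vec flip: indicator_inter_arith)
  then show ?thesis using assms by (simp add: fun_vec_const)
qed

text \<open>On the spectral subspace of a short interval, \<open>a\<close> is almost a scalar. The reason is
  positivity: on \<open>[u, u + h)\<close> the function \<open>h\<^sup>2 - (t - u)\<^sup>2\<close> is a square \<open>g\<^sup>2\<close>, and the difference of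
  the two squared norms is \<open>\<parallel>g(a) b\<parallel>\<^sup>2\<close>.\<close>

lemma norm_shift_fun_vec:
  fixes u h :: real
  assumes b: "b \<in> M" and h: "h > 0"
  defines "f \<equiv> (indicator {u..<u + h} :: real \<Rightarrow> real)"
  shows "norm (app (\<pi> a) (fun_vec f b) - complex_of_real u *\<^sub>C fun_vec f b)
    \<le> h * norm (fun_vec f b)"
proof -
  have f: "approximable f" unfolding f_def by (rule approximable_interval)
  define p where "p = [:-u, 1:]"
  define g where "g t = sqrt (max 0 (h\<^sup>2 - (t - u)\<^sup>2)) * f t" for t
  have g: "approximable g"
    unfolding g_def
    by (intro approximable_mult f approximable_continuous continuous_intros)
  have pf: "poly p t = t - u" for t by (simp add: p_def)
  have shift: "app (\<pi> a) (fun_vec f b) - complex_of_real u *\<^sub>C fun_vec f b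
      = fun_vec (\<lambda>t. poly p t * f t) b"
  proof -
    have "op_poly p a = a + (- complex_of_real u) *\<^sub>C 1"
      by (simp add: p_def op_poly_pCons scaleC_one algebra_simps)
    then have "app (\<pi> (op_poly p a)) \<zeta> = app (\<pi> a) \<zeta> - complex_of_real u *\<^sub>C \<zeta>" for \<zeta>
      by (simp only: \<pi>_add \<pi>_scaleC \<pi>_one a_M M_one M_scaleC) simp
    then show ?thesis using \<pi>_fun_vec[OF f b, of p] by simp
  qed
  have sq: "cinner (fun_vec k b) (fun_vec k b) = cinner (\<Lambda> b) (fun_vec (\<lambda>t. k t * k t) b)"
    if "approximable k" for k using that b by (simp add: cinner_fun_vec)
  have hf: "fun_vec (\<lambda>t. poly [:h:] t * f t) b = complex_of_real h *\<^sub>C fun_vec f b"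
    using \<pi>_fun_vec[OF f b, of "[:h:]"] by (simp add: op_poly_pCons \<pi>_scaleC \<pi>_one)
  have "(h * f t) * (h * f t) - ((t - u) * f t) * ((t - u) * f t) = g t * g t" for t
  proof (cases "t \<in> {u..<u+h}")
    case True
    then have "(t - u)\<^sup>2 \<le> h\<^sup>2" by (intro power_mono) auto
    with True show ?thesis by (simp add: g_def f_def power2_eq_square)
  qed (simp add: g_def f_def)
  then have "cinner (fun_vec g b) (fun_vec g b) = cinner (\<Lambda> b)
      (fun_vec (\<lambda>t. (h * f t) * (h * f t) - (poly p t * f t) * (poly p t * f t)) b)"
    by (simp only: sq[OF g] pf)
  also have "\<dots> = cinner (complex_of_real h *\<^sub>C fun_vec f b) (complex_of_real h *\<^sub>C fun_vec f b)
      - cinner (fun_vec (\<lambda>t. poly p t * f t) b) (fun_vec (\<lambda>t. poly p t * f t) b)"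
    using f b hf[symmetric]
    by (subst fun_vec_diff_left) (auto simp: cinner_diff_right sq)
  finally have "(norm (fun_vec g b))\<^sup>2
      = (h * norm (fun_vec f b))\<^sup>2 - (norm (fun_vec (\<lambda>t. poly p t * f t) b))\<^sup>2"
    unfolding cinner_self using h
    by (simp add: norm_scaleC power_mult_distrib flip: of_real_diff of_real_power of_real_mult)
  then have "(norm (fun_vec (\<lambda>t. poly p t * f t) b))\<^sup>2 \<le> (h * norm (fun_vec f b))\<^sup>2"
    using zero_le_power2[of "norm (fun_vec g b)"] by linarith
  then show ?thesis
    unfolding shift using h by (intro power2_le_imp_le[of "norm _"]) auto
qed

text \<open>The projections belonging to disjoint sets and to the complement of their union add up to the
  identity.\<close>

lemma fun_vec_partition:
  assumes b: "b \<in> M" and G: "finite G" and S: "\<And>k. k \<in> G \<Longrightarrow> approximable (indicator (S k))"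
    and disj: "disjoint_family_on S G"
  shows "\<Lambda> b - (\<Sum>k\<in>G. fun_vec (indicator (S k)) b) = fun_vec (indicator (- (\<Union>k\<in>G. S k))) b
    \<and> approximable (indicator (- (\<Union>k\<in>G. S k)))"
  using G S disj
proof (induction G)
  case empty
  then show ?case by (simp add: fun_vec_const[OF b] indicator_def[abs_def])
next
  case (insert k G)
  have "disjoint_family_on S G" using insert.prems(2) by (auto simp: disjoint_family_on_def)
  with insert have IH: "\<Lambda> b - (\<Sum>k\<in>G. fun_vec (indicator (S k)) b) = fun_vec (indicator (- (\<Union>k\<in>G. S k))) b"
    "approximable (indicator (- (\<Union>k\<in>G. S k)))" by auto
  have "S k \<inter> (\<Union>k\<in>G. S k) = {}"
    using insert.prems(2) insert.hyps by (auto simp: disjoint_family_on_def)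
  then have eq: "indicator (- (\<Union>k\<in>insert k G. S k))
      = (\<lambda>t. indicator (- (\<Union>k\<in>G. S k)) t - indicator (S k) t :: real)"
    by (auto simp: fun_eq_iff split: split_indicator)
  show ?case
    unfolding eq using IH insert.prems(1) insert.hyps b
    by (simp add: fun_vec_diff_left flip: IH(1))
qed


text \<open>The conclusion is \<open>Tr ([T, Y] X) = 0\<close>, where \<open>Y\<close> is left multiplication by \<open>a\<close> and \<open>X\<close> is right
  multiplication by \<open>x\<close>. Take the cells \<open>J\<^sub>k\<close> of a grid as in \<open>singular_grid_cover\<close>, and in each
  spectral subspace an orthonormal basis \<open>w\<^sub>k d\<close> of the span of the projections of the vectors
  \<open>\<Lambda> (\<alpha>\<^sub>i)\<close>. Summing over these vectors computes the trace up to the part of \<open>\<Lambda> (\<alpha>\<^sub>i x)\<close> outside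
  the cells, which has norm of order \<open>\<epsilon>\<^bsup>1/2\<^esup>\<close>. On the other hand \<open>Y\<close> may be replaced by \<open>Y - k h\<close> in the
  commutator, so each term is at most a constant times \<open>h\<close>. There are at most \<open>card I\<close> terms per
  cell, and the cells have total length at most \<open>\<epsilon>\<close>.\<close>

theorem trace_commutator_singular:
  fixes T :: "'h cop" and \<eta> :: "'i \<Rightarrow> 'h"
  assumes sing: "singular_wrt_lebesgue \<mu>"
    and I: "finite I" and \<alpha>: "\<And>i. i \<in> I \<Longrightarrow> \<alpha> i \<in> M" and x: "x \<in> M"
    and comm: "\<And>\<zeta>. app T (app (\<pi> a) \<zeta>) - app (\<pi> a) (app T \<zeta>)
        = (\<Sum>i\<in>I. cinner (\<eta> i) \<zeta> *\<^sub>C \<Lambda> (\<alpha> i))"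
  shows "(\<Sum>i\<in>I. cinner (\<eta> i) (\<Lambda> (\<alpha> i * x))) = 0"
proof -
  obtain Ct where Ct: "Ct \<ge> 0" "\<And>\<zeta>. norm (app T \<zeta>) \<le> Ct * norm \<zeta>" using app_bound by blast
  obtain Cx where Cx: "Cx \<ge> 0" "\<And>A. A \<in> M \<Longrightarrow> norm (\<Lambda> (A * x)) \<le> Cx * norm (\<Lambda> A)"
    using right_mult_bound[OF x] by blast
  have "\<exists>C. C \<ge> 0 \<and> (\<forall>f. approximable f \<longrightarrow>
      norm (fun_vec f (\<alpha> i * x)) \<le> C * sqrt (\<integral>t. (f t)\<^sup>2 \<partial>\<mu>))" if "i \<in> I" for i
    by (rule norm_fun_vec[OF M_mult[OF \<alpha>[OF that] x]]) blast
  then obtain Ca where Ca: "\<And>i. i \<in> I \<Longrightarrow> Ca i \<ge> 0"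
    "\<And>i f. i \<in> I \<Longrightarrow> approximable f \<Longrightarrow>
      norm (fun_vec f (\<alpha> i * x)) \<le> Ca i * sqrt (\<integral>t. (f t)\<^sup>2 \<partial>\<mu>)"
    by metis
  define S where "S = (\<Sum>i\<in>I. cinner (\<eta> i) (\<Lambda> (\<alpha> i * x)))"
  \<comment> \<open>Coefficients of the two errors: the diagonal terms, and the mass outside the cells.\<close>
  define E where "E = 2 * Ct * Cx * real (card I)"
  define E' where "E' = (\<Sum>i\<in>I. norm (\<eta> i) * Ca i)"
  have main: "cmod S \<le> E * \<epsilon> + E' * sqrt \<epsilon>" if \<epsilon>: "\<epsilon> > 0" for \<epsilon>
  proof -
    obtain h :: real and G :: "int set" where h: "h > 0" and G: "finite G"
      and len: "real (card G) * h \<le> \<epsilon>"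
      and rest: "measure \<mu> (- (\<Union>k\<in>G. {real_of_int k * h ..< (real_of_int k + 1) * h})) \<le> \<epsilon>"
      using singular_grid_cover[OF finite_measure_axioms sets_\<mu> sing \<epsilon>] by blast
    define J where "J k = {real_of_int k * h ..< real_of_int k * h + h}" for k
    define w where "w k = fun_vec (indicator (J k))" for k
    have J: "approximable (indicator (J k))" for k
      unfolding J_def by (rule approximable_interval)
    have J_iff: "t \<in> J k \<longleftrightarrow> k = \<lfloor>t / h\<rfloor>" for t k
      using h unfolding J_def by (auto simp: floor_eq_iff field_simps eq_commute[of k])
    have disj: "disjoint_family_on J G"
      unfolding disjoint_family_on_def using J_iff by (auto simp: set_eq_iff)
    define onb where "onb k B \<longleftrightarrow> finite B \<and> B \<subseteq> M \<and> card B \<le> card (\<alpha> ` I) \<and>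
       (\<forall>d\<in>B. \<forall>e\<in>B. cinner (w k d) (w k e) = (if d = e then 1 else 0)) \<and>
       (\<forall>b\<in>\<alpha> ` I. w k b = (\<Sum>d\<in>B. cinner (w k d) (w k b) *\<^sub>C w k d))" for k B
    have "\<exists>B. onb k B" for k
      unfolding onb_def w_def
      by (rule gram_schmidt) (use I \<alpha> J in \<open>auto simp: fun_vec_add_right fun_vec_scaleC_right\<close>)
    then obtain D where onb: "\<And>k. onb k (D k)" by metis
    have D: "finite (D k)" "D k \<subseteq> M" "card (D k) \<le> card (\<alpha> ` I)" for k
      using onb[of k] by (simp_all add: onb_def)
    have on: "cinner (w k d) (w k e) = (if d = e then 1 else 0)" if "d \<in> D k" "e \<in> D k" for k d e
      using onb[of k] that unfolding onb_def by blast
    have span: "w k (\<alpha> i) = (\<Sum>d\<in>D k. cinner (w k d) (w k (\<alpha> i)) *\<^sub>C w k d)" if "i \<in> I" for k i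
      using onb[of k] that unfolding onb_def by blast
    have DM: "d \<in> M" if "d \<in> D k" for d k using D(2) that by blast
    have w_x: "norm (w k (b * x)) \<le> Cx * norm (w k b)" if "b \<in> M" for b k
      unfolding w_def using norm_fun_vec_mult[OF J that x Cx(2)] by simp
    \<comment> \<open>An expansion in the basis survives right multiplication by \<open>x\<close>, because the kernel of \<open>w k\<close> is stable under it.\<close>
    have span_x: "w k (\<alpha> i * x) = (\<Sum>d\<in>D k. cinner (w k d) (w k (\<alpha> i)) *\<^sub>C w k (d * x))"
      if i: "i \<in> I" for k i
    proof -
      define v where "v = \<alpha> i - (\<Sum>d\<in>D k. cinner (w k d) (w k (\<alpha> i)) *\<^sub>C d)"
      have diff: "w k (b - c) = w k b - w k c" if "b \<in> M" "c \<in> M" for b c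
        using fun_vec_add_right[OF J[of k] M_diff[OF that] that(2)] by (simp add: w_def)
      have sum: "w k (sum f F) = (\<Sum>i\<in>F. w k (f i))" if "\<And>i. i \<in> F \<Longrightarrow> f i \<in> M"
        for f and F :: "'k cop set"
        unfolding w_def by (rule fun_vec_sum_right[OF J that])
      have sc: "w k (c *\<^sub>C b) = c *\<^sub>C w k b" if "b \<in> M" for c b
        unfolding w_def by (rule fun_vec_scaleC_right[OF J that])
      have vM: "v \<in> M" unfolding v_def using \<alpha>[OF i] DM by simp
      have "w k v = 0"
        unfolding v_def using \<alpha>[OF i] DM span[OF i] by (simp add: diff sum sc)
      then have "w k (v * x) = 0" using w_x[OF vM, of k] by simp
      moreover have "v * x = \<alpha> i * x - (\<Sum>d\<in>D k. cinner (w k d) (w k (\<alpha> i)) *\<^sub>C (d * x))"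
        by (simp add: v_def left_diff_distrib sum_distrib_right cop_scaleC_mult_left)
      ultimately show ?thesis
        using \<alpha>[OF i] DM x by (simp add: diff sum sc)
    qed
    have approx: "norm (\<Lambda> (\<alpha> i * x) - (\<Sum>k\<in>G. w k (\<alpha> i * x))) \<le> Ca i * sqrt \<epsilon>" if i: "i \<in> I" for i
    proof -
      define R where "R = - (\<Union>k\<in>G. J k)"
      have part: "\<Lambda> (\<alpha> i * x) - (\<Sum>k\<in>G. w k (\<alpha> i * x)) = fun_vec (indicator R) (\<alpha> i * x)"
        "approximable (indicator R)"
        using fun_vec_partition[of "\<alpha> i * x" G J] \<alpha>[OF i] x G J disj by (auto simp: w_def R_def)
      have R: "R \<in> sets borel" unfolding R_def J_def by (intro borel_comp sets.finite_UN G) auto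
      have "(\<integral>t. (indicator R t)\<^sup>2 \<partial>\<mu>) = measure \<mu> R"
        using R by (simp add: power2_eq_square flip: indicator_inter_arith)
      also have "\<dots> \<le> \<epsilon>"
        using rest by (simp add: R_def J_def distrib_right)
      finally have "sqrt (\<integral>t. (indicator R t)\<^sup>2 \<partial>\<mu>) \<le> sqrt \<epsilon>" by simp
      then show ?thesis
        unfolding part(1) using Ca(2)[OF i part(2)] Ca(1)[OF i]
        by (meson mult_left_mono order_trans)
    qed
    define F where "F \<zeta> = app T (app (\<pi> a) \<zeta>) - app (\<pi> a) (app T \<zeta>)" for \<zeta>
    \<comment> \<open>The sum \<open>\<Sum> \<langle>e, [T, Y] X e\<rangle>\<close> over all basis vectors \<open>e = w k d\<close>.\<close>
    define Tr where "Tr = (\<Sum>k\<in>G. \<Sum>d\<in>D k. cinner (w k d) (F (w k (d * x))))"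
    have Tr_eq: "Tr = (\<Sum>i\<in>I. cinner (\<eta> i) (\<Sum>k\<in>G. w k (\<alpha> i * x)))"
    proof -
      have "cinner (w k d) (F (w k (d * x)))
          = (\<Sum>i\<in>I. cinner (\<eta> i) (cinner (w k d) (w k (\<alpha> i)) *\<^sub>C w k (d * x)))"
        if "d \<in> D k" for k d
      proof -
        have "cinner (w k d) (\<Lambda> (\<alpha> i)) = cinner (w k d) (w k (\<alpha> i))" if "i \<in> I" for i
          unfolding w_def by (rule fun_vec_projection[OF J DM[OF \<open>d \<in> D k\<close>] \<alpha>[OF that]])
        then show ?thesis
          unfolding F_def comm cinner_sum_right
          by (intro sum.cong) (simp_all add: cinner_scaleC_right mult.commute)
      qed
      then have "Tr = (\<Sum>k\<in>G. \<Sum>d\<in>D k. \<Sum>i\<in>I.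
          cinner (\<eta> i) (cinner (w k d) (w k (\<alpha> i)) *\<^sub>C w k (d * x)))"
        unfolding Tr_def by simp
      also have "\<dots> = (\<Sum>k\<in>G. \<Sum>i\<in>I. \<Sum>d\<in>D k.
          cinner (\<eta> i) (cinner (w k d) (w k (\<alpha> i)) *\<^sub>C w k (d * x)))"
        by (intro sum.cong refl sum.swap)
      also have "\<dots> = (\<Sum>i\<in>I. \<Sum>k\<in>G. \<Sum>d\<in>D k.
          cinner (\<eta> i) (cinner (w k d) (w k (\<alpha> i)) *\<^sub>C w k (d * x)))"
        by (rule sum.swap)
      also have "\<dots> = (\<Sum>i\<in>I. cinner (\<eta> i) (\<Sum>k\<in>G. w k (\<alpha> i * x)))"
        by (intro sum.cong refl) (simp add: cinner_sum_right span_x)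
      finally show ?thesis .
    qed
    have Tr_le: "cmod Tr \<le> E * \<epsilon>"
    proof -
      have term_le: "cmod (cinner (w k d) (F (w k (d * x)))) \<le> 2 * Ct * Cx * h"
        if d: "d \<in> D k" for k d
      proof -
        define s where "s = complex_of_real (real_of_int k * h)"
        \<comment> \<open>Replacing \<open>Y\<close> by \<open>A = Y - k h\<close> does not change the commutator.\<close>
        define A where "A \<zeta> = app (\<pi> a) \<zeta> - s *\<^sub>C \<zeta>" for \<zeta>
        define p where "p = w k d"
        define q where "q = w k (d * x)"
        have p1: "norm p = 1"
        proof -
          have "(norm p)\<^sup>2 = 1"
            using on[OF d d] unfolding p_def[symmetric] cinner_self by (simp flip: of_real_power)
          then show ?thesis using norm_ge_zero[of p] by (simp add: power2_eq_1_iff)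
        qed
        have q: "norm q \<le> Cx" using w_x[OF DM[OF d], of k] p1 by (simp add: p_def q_def)
        have Ap: "norm (A p) \<le> h"
          using norm_shift_fun_vec[OF DM[OF d] h, of "real_of_int k * h"] p1
          by (simp add: A_def p_def w_def J_def s_def)
        have "norm (A q) \<le> h * norm q"
          using norm_shift_fun_vec[OF M_mult[OF DM[OF d] x] h, of "real_of_int k * h"]
          by (simp add: A_def q_def w_def J_def s_def)
        then have Aq: "norm (A q) \<le> h * Cx"
          using mult_left_mono[OF q, of h] h by linarith
        have "cinner p (app (\<pi> a) (app T q)) = cinner (A p) (app T q) + s * cinner p (app T q)"
          by (simp add: A_def cinner_diff_left cinner_scaleC_left \<pi>_a_cinner s_def)
        moreover have "app T (app (\<pi> a) q) = app T (A q) + s *\<^sub>C app T q"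
          by (simp add: A_def app_diff app_scaleC)
        ultimately have "cinner p (F q) = cinner p (app T (A q)) - cinner (A p) (app T q)"
          by (simp add: F_def cinner_diff_right cinner_add_right cinner_scaleC_right)
        also have "cmod \<dots> \<le> norm p * norm (app T (A q)) + norm (A p) * norm (app T q)"
          by (intro order_trans[OF norm_triangle_ineq4] add_mono cinner_cauchy_schwarz)
        also have "\<dots> \<le> 1 * (Ct * (h * Cx)) + h * (Ct * Cx)"
        proof (intro add_mono mult_mono)
          show "norm (app T (A q)) \<le> Ct * (h * Cx)"
            using Ct(2)[of "A q"] mult_left_mono[OF Aq Ct(1)] by linarith
          show "norm (app T q) \<le> Ct * Cx"
            using Ct(2)[of q] mult_left_mono[OF q Ct(1)] by linarith
        qed (use p1 Ap h in auto)
        finally show ?thesis by (simp add: p_def q_def mult_ac)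
      qed
      have "cmod Tr \<le> (\<Sum>k\<in>G. \<Sum>d\<in>D k. 2 * Ct * Cx * h)"
        unfolding Tr_def
        by (intro order_trans[OF norm_sum] sum_mono term_le)
      also have "\<dots> \<le> (\<Sum>k\<in>G. real (card I) * (2 * Ct * Cx * h))"
      proof (rule sum_mono)
        fix k
        have "card (D k) \<le> card I" using D(3)[of k] card_image_le[OF I, of \<alpha>] by linarith
        then show "(\<Sum>d\<in>D k. 2 * Ct * Cx * h) \<le> real (card I) * (2 * Ct * Cx * h)"
          using Ct(1) Cx(1) h by (simp add: mult_right_mono)
      qed
      also have "\<dots> = E * (real (card G) * h)" by (simp add: E_def)
      also have "\<dots> \<le> E * \<epsilon>"
        by (rule mult_left_mono[OF len]) (use Ct(1) Cx(1) in \<open>simp add: E_def\<close>)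
      finally show ?thesis .
    qed
    have "S - Tr = (\<Sum>i\<in>I. cinner (\<eta> i) (\<Lambda> (\<alpha> i * x) - (\<Sum>k\<in>G. w k (\<alpha> i * x))))"
      unfolding S_def Tr_eq by (simp add: cinner_diff_right sum_subtractf)
    also have "cmod \<dots> \<le> (\<Sum>i\<in>I. norm (\<eta> i) * (Ca i * sqrt \<epsilon>))"
      by (intro order_trans[OF norm_sum] sum_mono order_trans[OF cinner_cauchy_schwarz]
          mult_left_mono approx) auto
    also have "\<dots> = E' * sqrt \<epsilon>" by (simp add: E'_def sum_distrib_right mult.assoc)
    finally show ?thesis using Tr_le norm_triangle_ineq2[of S Tr] by linarith
  qed
  have "((\<lambda>\<epsilon>. E * \<epsilon> + E' * sqrt \<epsilon>) \<longlongrightarrow> E * 0 + E' * sqrt 0) (at_right 0)"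
    by (intro tendsto_intros)
  then have "cmod S \<le> E * 0 + E' * sqrt 0"
    by (rule tendsto_lowerbound)
       (use main in \<open>auto simp: eventually_at_right_field intro: exI[of _ 1]\<close>)
  then show ?thesis by (simp add: S_def)
qed

end

section \<open>Words\<close>

text \<open>The pairs \<open>(u, v)\<close> are the terms \<open>u \<otimes> v\<close> of the free difference quotient \<open>\<partial>\<^sub>j w\<close>; the words
  \<open>v @ u\<close> are the terms of the cyclic derivative \<open>D\<^sub>j w\<close>.\<close>

definition occurrences :: "'i \<Rightarrow> 'i list \<Rightarrow> ('i list \<times> 'i list) set" where
  "occurrences j w = {(u, v). w = u @ j # v}"

lemma occurrences_Nil [simp]: "occurrences j [] = {}"
  by (auto simp: occurrences_def)

lemma occurrences_Cons:
  "occurrences j (i # w) = (if i = j then {([], w)} else {}) \<union> (\<lambda>(u, v). (i # u, v)) ` occurrences j w"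
  by (auto simp: occurrences_def Cons_eq_append_conv image_iff)

lemma finite_occurrences [simp]: "finite (occurrences j w)"
  by (induction w) (auto simp: occurrences_Cons)

lemma occurrences_subset: "(u, v) \<in> occurrences j w \<Longrightarrow> set u \<subseteq> set w \<and> set v \<subseteq> set w"
  by (auto simp: occurrences_def)

lemma sum_occurrences_Cons:
  fixes f :: "'i list \<Rightarrow> 'i list \<Rightarrow> 'a::comm_monoid_add"
  shows "(\<Sum>(u, v)\<in>occurrences j (i # w). f u v)
    = (if i = j then f [] w else 0) + (\<Sum>(u, v)\<in>occurrences j w. f (i # u) v)"
proof -
  have inj: "inj_on (\<lambda>(u, v). (i # u, v)) (occurrences j w)" by (auto simp: inj_on_def)
  have "(\<Sum>(u, v)\<in>occurrences j (i # w). f u v) = (\<Sum>(u, v)\<in>(if i = j then {([], w)} else {}). f u v)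
      + (\<Sum>(u, v)\<in>(\<lambda>(u, v). (i # u, v)) ` occurrences j w. f u v)"
    unfolding occurrences_Cons by (rule sum.union_disjoint) auto
  also have "(\<Sum>(u, v)\<in>(\<lambda>(u, v). (i # u, v)) ` occurrences j w. f u v) = (\<Sum>(u, v)\<in>occurrences j w. f (i # u) v)"
    by (subst sum.reindex[OF inj]) (simp add: split_def o_def)
  finally show ?thesis by simp
qed

text \<open>The Leibniz rule for the free difference quotient.\<close>

lemma sum_occurrences_append:
  fixes f :: "'i list \<Rightarrow> 'i list \<Rightarrow> 'a::comm_monoid_add"
  shows "(\<Sum>(u, v)\<in>occurrences j (w @ w'). f u v)
    = (\<Sum>(u, v)\<in>occurrences j w. f u (v @ w')) + (\<Sum>(u, v)\<in>occurrences j w'. f (w @ u) v)"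
  by (induction w arbitrary: f) (simp_all add: sum_occurrences_Cons add.assoc)

lemma sum_occurrences_letters:
  assumes "finite J" "set w \<subseteq> J"
  shows "(\<Sum>j\<in>J. \<Sum>(u, v)\<in>occurrences j w. c :: complex) = of_nat (length w) * c"
  using assms(2)
proof (induction w)
  case (Cons i w)
  have "(\<Sum>j\<in>J. \<Sum>(u, v)\<in>occurrences j (i # w). c)
      = (\<Sum>j\<in>J. (if i = j then c else 0) + (\<Sum>(u, v)\<in>occurrences j w. c))"
    by (simp only: sum_occurrences_Cons)
  also have "\<dots> = c + of_nat (length w) * c"
    using Cons assms(1) by (simp add: sum.distrib)
  finally show ?case by (simp add: algebra_simps)
qed simp

definition words_upto :: "'i set \<Rightarrow> nat \<Rightarrow> 'i list set" where
  "words_upto J d = {w. set w \<subseteq> J \<and> length w \<le> d}"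

lemma finite_words_upto [simp]: "finite J \<Longrightarrow> finite (words_upto J d)"
  unfolding words_upto_def by (rule finite_lists_length_le)

text \<open>Regroups the free difference quotients of all words of length at most \<open>d + 1\<close> by their left and
  right factors, which have length at most \<open>d\<close>.\<close>

lemma sum_occurrences_words:
  fixes g :: "'i list \<Rightarrow> 'i list \<Rightarrow> 'i list \<Rightarrow> 'a::comm_monoid_add"
  assumes J: "finite J"
  shows "(\<Sum>w\<in>words_upto J (Suc d). \<Sum>(u, v)\<in>occurrences j w. g w u v)
    = (\<Sum>u\<in>words_upto J d. \<Sum>v\<in>words_upto J d.
        if u @ j # v \<in> words_upto J (Suc d) then g (u @ j # v) u v else 0)"
proof -
  let ?L = "words_upto J d"
  have "(\<Sum>(u, v)\<in>occurrences j w. g w u v) = (\<Sum>(u, v)\<in>?L \<times> ?L. if w = u @ j # v then g w u v else 0)"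
    if "w \<in> words_upto J (Suc d)" for w
  proof (rule sum.mono_neutral_cong_left)
    show "occurrences j w \<subseteq> ?L \<times> ?L" using that by (auto simp: occurrences_def words_upto_def)
  qed (use J in \<open>auto simp: occurrences_def split: if_splits\<close>)
  then have "(\<Sum>w\<in>words_upto J (Suc d). \<Sum>(u, v)\<in>occurrences j w. g w u v)
      = (\<Sum>w\<in>words_upto J (Suc d). \<Sum>p\<in>?L \<times> ?L.
          if w = fst p @ j # snd p then g w (fst p) (snd p) else 0)"
    by (simp add: split_def)
  also have "\<dots> = (\<Sum>p\<in>?L \<times> ?L. \<Sum>w\<in>words_upto J (Suc d).
      if w = fst p @ j # snd p then g w (fst p) (snd p) else 0)"
    by (rule sum.swap)
  also have "\<dots> = (\<Sum>p\<in>?L \<times> ?L. if fst p @ j # snd p \<in> words_upto J (Suc d)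
      then g (fst p @ j # snd p) (fst p) (snd p) else 0)"
    using J by (intro sum.cong refl) simp
  also have "\<dots> = (\<Sum>u\<in>?L. \<Sum>v\<in>?L.
      if u @ j # v \<in> words_upto J (Suc d) then g (u @ j # v) u v else 0)"
    by (simp add: sum.cartesian_product split_def)
  finally show ?thesis .
qed


section \<open>Algebraic freeness\<close>

locale dual_system_L2 = tracial_L2 M \<tau> \<Lambda> \<pi>
  for M :: "'k::chilbert_space cop set" and \<tau> and \<Lambda> :: "'k cop \<Rightarrow> 'h::chilbert_space" and \<pi> +
  fixes m :: nat and y :: "nat \<Rightarrow> 'k cop" and P :: "'h cop" and R :: "nat \<Rightarrow> 'h cop"
  assumes y_M: "j \<in> {1..m} \<Longrightarrow> y j \<in> M"
    and proj: "orthogonal_projection_onto P (range (\<lambda>c. c *\<^sub>C \<Lambda> 1))"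
    and dual: "dual_system m (\<lambda>k. \<pi> (y k)) P R"
begin

definition monomial :: "nat list \<Rightarrow> 'k cop" where
  "monomial w = prod_list (map y w)"

lemma monomial_simps [simp]:
  "monomial [] = 1" "monomial (j # w) = y j * monomial w"
  "monomial (u @ v) = monomial u * monomial v"
  by (simp_all add: monomial_def)

lemma monomial_M [simp]: "set w \<subseteq> {1..m} \<Longrightarrow> monomial w \<in> M"
  by (induction w) (auto simp: y_M)

lemma P_apply: "app P \<zeta> = cinner (\<Lambda> 1) \<zeta> *\<^sub>C \<Lambda> 1"
proof -
  obtain c where c: "app P \<zeta> = c *\<^sub>C \<Lambda> 1"
    using proj unfolding orthogonal_projection_onto_def by blast
  have "cinner (1 *\<^sub>C \<Lambda> 1) (\<zeta> - app P \<zeta>) = 0"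
    using proj unfolding orthogonal_projection_onto_def by blast
  moreover have "cinner (\<Lambda> 1) (\<Lambda> 1) = 1"
    by (simp add: cinner_\<Lambda> \<tau>_one)
  ultimately show ?thesis
    by (simp add: c scaleC_one cinner_diff_right cinner_scaleC_right)
qed

lemma dual_commutator:
  assumes "j \<in> {1..m}" "i \<in> {1..m}"
  shows "app (R j) (app (\<pi> (y i)) \<zeta>) - app (\<pi> (y i)) (app (R j) \<zeta>)
    = (if i = j then cinner (\<Lambda> 1) \<zeta> *\<^sub>C \<Lambda> 1 else 0)"
proof -
  have "R j * \<pi> (y i) - \<pi> (y i) * R j = (if i = j then P else 0)"
    using dual assms unfolding dual_system_def commutator_def by auto
  from arg_cong[OF this, of "\<lambda>T. app T \<zeta>"] show ?thesis
    by (auto simp: app_simps P_apply)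
qed

text \<open>As \<open>[R\<^sub>j, _]\<close> is a derivation with value \<open>\<delta>\<^bsub>j=k\<^esub> P\<^sub>1\<close> at \<open>y\<^sub>k\<close>, it maps \<open>w\<close> to the sum of the
  rank-one operators \<open>u P\<^sub>1 v\<close> over the terms \<open>u \<otimes> v\<close> of \<open>\<partial>\<^sub>j w\<close>.\<close>

lemma commutator_monomial:
  assumes j: "j \<in> {1..m}" and w: "set w \<subseteq> {1..m}"
  shows "app (R j) (app (\<pi> (monomial w)) \<zeta>) - app (\<pi> (monomial w)) (app (R j) \<zeta>)
    = (\<Sum>(u, v)\<in>occurrences j w. cinner (\<Lambda> 1) (app (\<pi> (monomial v)) \<zeta>) *\<^sub>C \<Lambda> (monomial u))"
  using w
proof (induction w)
  case Nil
  then show ?case by (simp add: \<pi>_one)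
next
  case (Cons i w)
  then have i: "i \<in> {1..m}" and w: "set w \<subseteq> {1..m}" by auto
  let ?Y = "app (\<pi> (y i))" and ?W = "app (\<pi> (monomial w))" and ?R = "app (R j)"
  have "app (\<pi> (monomial (i # w))) \<xi> = ?Y (?W \<xi>)" for \<xi>
    using i w by (simp add: \<pi>_mult y_M)
  then have "?R (app (\<pi> (monomial (i # w))) \<zeta>) - app (\<pi> (monomial (i # w))) (?R \<zeta>)
      = (?R (?Y (?W \<zeta>)) - ?Y (?R (?W \<zeta>))) + ?Y (?R (?W \<zeta>) - ?W (?R \<zeta>))"
    by (simp add: app_diff)
  also have "?Y (?R (?W \<zeta>) - ?W (?R \<zeta>)) = (\<Sum>(u, v)\<in>occurrences j w.
      cinner (\<Lambda> 1) (app (\<pi> (monomial v)) \<zeta>) *\<^sub>C \<Lambda> (monomial (i # u)))"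
    unfolding Cons.IH[OF w] app_sum
  proof (intro sum.cong refl)
    fix p assume "p \<in> occurrences j w"
    then have p: "set (fst p) \<subseteq> {1..m}" using w by (metis occurrences_subset prod.collapse subset_trans)
    then show "?Y (case p of (u, v) \<Rightarrow>
          cinner (\<Lambda> 1) (app (\<pi> (monomial v)) \<zeta>) *\<^sub>C \<Lambda> (monomial u))
        = (case p of (u, v) \<Rightarrow>
          cinner (\<Lambda> 1) (app (\<pi> (monomial v)) \<zeta>) *\<^sub>C \<Lambda> (monomial (i # u)))"
      by (simp add: split_def app_scaleC \<pi>_\<Lambda>[OF y_M[OF i] monomial_M[OF p]])
  qed
  also have "(?R (?Y (?W \<zeta>)) - ?Y (?R (?W \<zeta>)))
      = (if i = j then cinner (\<Lambda> 1) (?W \<zeta>) *\<^sub>C \<Lambda> (monomial []) else 0)"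
    using dual_commutator[OF j i, of "?W \<zeta>"] by simp
  finally show ?case by (simp only: sum_occurrences_Cons)
qed

lemma commutator_polynomial:
  assumes j: "j \<in> {1..m}" and V: "\<And>w. w \<in> V \<Longrightarrow> set w \<subseteq> {1..m}"
    and b: "b = (\<Sum>w\<in>V. c w *\<^sub>C monomial w)"
  shows "app (R j) (app (\<pi> b) \<zeta>) - app (\<pi> b) (app (R j) \<zeta>)
    = (\<Sum>w\<in>V. \<Sum>(u, v)\<in>occurrences j w.
        (c w * cinner (\<Lambda> 1) (app (\<pi> (monomial v)) \<zeta>)) *\<^sub>C \<Lambda> (monomial u))"
proof -
  have "app (\<pi> b) \<xi> = (\<Sum>w\<in>V. c w *\<^sub>C app (\<pi> (monomial w)) \<xi>)" for \<xi>
    unfolding b using V by (simp add: \<pi>_sum \<pi>_scaleC)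
  then have "app (R j) (app (\<pi> b) \<zeta>) - app (\<pi> b) (app (R j) \<zeta>)
      = (\<Sum>w\<in>V. c w *\<^sub>C (app (R j) (app (\<pi> (monomial w)) \<zeta>)
          - app (\<pi> (monomial w)) (app (R j) \<zeta>)))"
    by (simp add: app_sum app_scaleC scaleC_diff_right sum_subtractf)
  also have "\<dots> = (\<Sum>w\<in>V. \<Sum>(u, v)\<in>occurrences j w.
        (c w * cinner (\<Lambda> 1) (app (\<pi> (monomial v)) \<zeta>)) *\<^sub>C \<Lambda> (monomial u))"
    by (intro sum.cong refl, subst commutator_monomial[OF j V])
       (auto simp: complex_vector.scale_sum_right scaleC_scaleC split_def)
  finally show ?thesis .
qed

abbreviation "words \<equiv> words_upto {1..m}"

text \<open>Induction on the degree. Applying \<open>[R\<^sub>j, _]\<close> to a relation and evaluating at \<open>\<Lambda> b\<close> gives, for each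
  \<open>b\<close>, a relation of smaller degree, whose coefficient at the empty word is
  \<open>\<tau> ((\<Sum>\<^sub>v c (j v) v) b)\<close>. It vanishes for all \<open>b\<close>, so \<open>\<Sum>\<^sub>v c (j v) v\<close> is again a relation of smaller
  degree, and the coefficients of all words starting with \<open>j\<close> are zero. What remains is the constant
  term.\<close>

lemma monomials_independent:
  assumes "(\<Sum>w\<in>words d. c w *\<^sub>C monomial w) = 0" "w \<in> words d"
  shows "c w = 0"
  using assms
proof (induction d arbitrary: c w)
  case 0
  have "words 0 = {[]}" by (auto simp: words_upto_def)
  with 0 have "w = []" "c [] *\<^sub>C (1 :: 'k cop) = 0" by auto
  then show ?case by (metis M_one \<tau>_scaleC \<tau>_zero \<tau>_one mult_1_right)
next
  case (Suc d)
  have wM: "monomial w \<in> M" if "w \<in> words k" for w k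
    using that by (simp add: words_upto_def)
  have zero: "c (j # v) = 0" if jv: "j # v \<in> words (Suc d)" for j v
  proof -
    have j: "j \<in> {1..m}" and v: "v \<in> words d" using jv by (auto simp: words_upto_def)
    \<comment> \<open>Extended by \<open>0\<close> to the words that do not come from the given relation.\<close>
    define c' where "c' v = (if j # v \<in> words (Suc d) then c (j # v) else 0)" for v
    have "\<tau> ((\<Sum>v\<in>words d. c' v *\<^sub>C monomial v) * b) = 0" if b: "b \<in> M" for b
    proof -
      define C where "C u = (\<Sum>v\<in>words d. if u @ j # v \<in> words (Suc d)
          then c (u @ j # v) * cinner (\<Lambda> 1) (app (\<pi> (monomial v)) (\<Lambda> b)) else 0)" for u
      have "app (\<pi> 0) \<xi> = 0" for \<xi>
        using \<pi>_scaleC[OF M_one, of 0] by simp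
      then have "0 = app (R j) (app (\<pi> 0) (\<Lambda> b)) - app (\<pi> 0) (app (R j) (\<Lambda> b))"
        by (simp add: app_0)
      also have "\<dots> = (\<Sum>w\<in>words (Suc d). \<Sum>(u, v)\<in>occurrences j w.
        (c w * cinner (\<Lambda> 1) (app (\<pi> (monomial v)) (\<Lambda> b))) *\<^sub>C \<Lambda> (monomial u))"
        by (rule commutator_polynomial[OF j])
           (use Suc.prems in \<open>auto simp: words_upto_def\<close>)
      also have "\<dots> = (\<Sum>u\<in>words d. C u *\<^sub>C \<Lambda> (monomial u))"
        unfolding C_def complex_vector.scale_sum_left
        by (subst sum_occurrences_words) (auto intro!: sum.cong)
      also have "\<dots> = \<Lambda> (\<Sum>u\<in>words d. C u *\<^sub>C monomial u)"
        using wM by (simp add: \<Lambda>_sum \<Lambda>_scaleC)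
      finally have "(\<Sum>u\<in>words d. C u *\<^sub>C monomial u) = 0"
        using wM by (intro \<Lambda>_eq_0) auto
      moreover have "[] \<in> words d" by (simp add: words_upto_def)
      ultimately have "C [] = 0" by (rule Suc.IH)
      also have "C [] = (\<Sum>v\<in>words d. c' v * \<tau> (monomial v * b))"
        unfolding C_def c'_def using b wM
        by (intro sum.cong) (auto simp: \<pi>_\<Lambda> cinner_\<Lambda>)
      also have "\<dots> = \<tau> ((\<Sum>v\<in>words d. c' v *\<^sub>C monomial v) * b)"
        using b wM by (simp add: sum_distrib_right cop_scaleC_mult_left \<tau>_sum \<tau>_scaleC)
      finally show ?thesis .
    qed
    then have "(\<Sum>v\<in>words d. c' v *\<^sub>C monomial v) = 0"
      using wM by (intro \<tau>_nondegenerate) auto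
    from Suc.IH[OF this v] show ?thesis using jv by (simp add: c'_def)
  qed
  show ?case
  proof (cases w)
    case Nil
    have "(\<Sum>w\<in>words (Suc d). c w *\<^sub>C monomial w) = (\<Sum>w\<in>{[]}. c w *\<^sub>C monomial w)"
    proof (rule sum.mono_neutral_right)
      show "\<forall>w\<in>words (Suc d) - {[]}. c w *\<^sub>C monomial w = 0"
      proof
        fix w assume "w \<in> words (Suc d) - {[]}"
        then show "c w *\<^sub>C monomial w = 0" using zero by (cases w) auto
      qed
    qed (auto simp: words_upto_def finite_lists_length_le)
    then have "c [] *\<^sub>C (1 :: 'k cop) = 0" using Suc.prems(1) by simp
    then show ?thesis using Nil by (metis M_one \<tau>_scaleC \<tau>_zero \<tau>_one mult_1_right)
  qed (use zero Suc.prems(2) in auto)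
qed

text \<open>Independence for families in which words may repeat: coefficients need not vanish then, but a
  relation is annihilated by every linear functional \<open>f\<close> on formal polynomials.\<close>

lemma monomials_free:
  fixes f :: "nat list \<Rightarrow> complex"
  assumes I: "finite I" and v: "\<And>i. i \<in> I \<Longrightarrow> set (v i) \<subseteq> {1..m}"
    and zero: "(\<Sum>i\<in>I. c i *\<^sub>C monomial (v i)) = 0"
  shows "(\<Sum>i\<in>I. c i * f (v i)) = 0"
proof -
  define d where "d = (\<Sum>i\<in>I. length (v i))"
  have sub: "v ` I \<subseteq> words d"
    unfolding words_upto_def d_def using v I by (auto intro: member_le_sum)
  define C where "C w = sum c {i \<in> I. v i = w}" for w
  have "(\<Sum>w\<in>words d. C w *\<^sub>C monomial w)
      = (\<Sum>w\<in>words d. \<Sum>i\<in>{i \<in> I. v i = w}. c i *\<^sub>C monomial (v i))"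
    unfolding C_def complex_vector.scale_sum_left by (intro sum.cong) auto
  also have "\<dots> = (\<Sum>i\<in>I. c i *\<^sub>C monomial (v i))"
    by (rule sum.group) (use I sub in auto)
  finally have C0: "C w = 0" if "w \<in> words d" for w
    using monomials_independent[OF _ that] zero by simp
  have "(\<Sum>i\<in>I. c i * f (v i)) = (\<Sum>w\<in>words d. \<Sum>i\<in>{i \<in> I. v i = w}. c i * f (v i))"
    by (rule sum.group[symmetric]) (use I sub in auto)
  also have "\<dots> = (\<Sum>w\<in>words d. C w * f w)"
    unfolding C_def sum_distrib_right by (intro sum.cong) auto
  finally show ?thesis using C0 by simp
qed

text \<open>Freeness allows applying to \<open>D\<^sub>j = 0\<close> the functional that sends a word \<open>x\<close> to \<open>\<tau> (y\<^sub>j x) / (\<bar>x\<bar> + 1)\<close>.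
  On each term \<open>v u\<close> of \<open>D\<^sub>j w\<close> it takes the value \<open>\<tau> (w) / \<bar>w\<bar>\<close>, because \<open>j v u\<close> is a rotation of
  \<open>w = u j v\<close>. A word has \<open>\<bar>w\<bar>\<close> such terms over all \<open>j\<close>, so summation over \<open>j\<close> gives the trace of the
  nonconstant part, which is therefore zero.\<close>

lemma trace_of_cyclic_derivative_zero:
  assumes I: "finite I" and w: "\<And>i. i \<in> I \<Longrightarrow> set (w i) \<subseteq> {1..m}"
    and zero: "\<And>j. j \<in> {1..m} \<Longrightarrow>
      (\<Sum>i\<in>I. \<Sum>(u, v)\<in>occurrences j (w i). c i *\<^sub>C monomial (v @ u)) = 0"
  shows "\<tau> (\<Sum>i\<in>I. c i *\<^sub>C monomial (w i)) = (\<Sum>i\<in>{i \<in> I. w i = []}. c i)"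
proof -
  define g where "g i = \<tau> (monomial (w i)) / of_nat (length (w i))" for i
  have "(\<Sum>i\<in>I. \<Sum>(u, v)\<in>occurrences j (w i). c i * g i) = 0" if j: "j \<in> {1..m}" for j
  proof -
    define f where "f x = \<tau> (monomial (j # x)) / of_nat (length x + 1)" for x
    define S where "S = Sigma I (\<lambda>i. occurrences j (w i))"
    have "(\<Sum>s\<in>S. c (fst s) * f (snd (snd s) @ fst (snd s))) = 0"
    proof (rule monomials_free)
      show "finite S" unfolding S_def using I by auto
      show "set (snd (snd s) @ fst (snd s)) \<subseteq> {1..m}" if "s \<in> S" for s
        using that w occurrences_subset[of "fst (snd s)" "snd (snd s)"] unfolding S_def by fastforce
      show "(\<Sum>s\<in>S. c (fst s) *\<^sub>C monomial (snd (snd s) @ fst (snd s))) = 0"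
        using zero[OF j] I by (simp add: S_def sum.Sigma split_def)
    qed
    then have "(\<Sum>i\<in>I. \<Sum>(u, v)\<in>occurrences j (w i). c i * f (v @ u)) = 0"
      using I by (simp add: S_def sum.Sigma split_def)
    moreover have "f (v @ u) = g i" if "(u, v) \<in> occurrences j (w i)" "i \<in> I" for u v i
    proof -
      have wi: "w i = u @ j # v" using that by (simp add: occurrences_def)
      have "set u \<subseteq> {1..m}" "set (j # v) \<subseteq> {1..m}" using w[OF that(2)] by (auto simp: wi)
      then have "\<tau> (monomial (j # v) * monomial u) = \<tau> (monomial u * monomial (j # v))"
        by (intro \<tau>_trace monomial_M)
      then show ?thesis by (simp add: f_def g_def wi mult.assoc add.commute)
    qed
    then have "(\<Sum>i\<in>I. \<Sum>(u, v)\<in>occurrences j (w i). c i * f (v @ u))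
        = (\<Sum>i\<in>I. \<Sum>(u, v)\<in>occurrences j (w i). c i * g i)"
      by (intro sum.cong refl) auto
    ultimately show ?thesis by simp
  qed
  then have "0 = (\<Sum>j\<in>{1..m}. \<Sum>i\<in>I. \<Sum>(u, v)\<in>occurrences j (w i). c i * g i)" by simp
  also have "\<dots> = (\<Sum>i\<in>I. \<Sum>j\<in>{1..m}. \<Sum>(u, v)\<in>occurrences j (w i). c i * g i)" by (rule sum.swap)
  also have "\<dots> = (\<Sum>i\<in>I. of_nat (length (w i)) * (c i * g i))"
    using w by (intro sum.cong refl sum_occurrences_letters) auto
  also have "\<dots> = (\<Sum>i\<in>I. c i * \<tau> (monomial (w i)) - (if w i = [] then c i else 0))"
    by (intro sum.cong) (auto simp: g_def \<tau>_one)
  also have "\<dots> = \<tau> (\<Sum>i\<in>I. c i *\<^sub>C monomial (w i)) - (\<Sum>i\<in>{i \<in> I. w i = []}. c i)"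
    using w I by (simp add: sum_subtractf \<tau>_sum \<tau>_scaleC sum.inter_filter)
  finally show ?thesis by simp
qed

end

section \<open>Vanishing cyclic derivatives\<close>

locale dual_system_singular = dual_system_L2 M \<tau> \<Lambda> \<pi> m y P R + spectral_element M \<tau> \<Lambda> \<pi> \<mu> a r
  for M :: "'k::chilbert_space cop set" and \<tau> and \<Lambda> :: "'k cop \<Rightarrow> 'h::chilbert_space" and \<pi>
    and m y and P :: "'h cop" and R \<mu> a r +
  fixes V :: "nat list set" and c :: "nat list \<Rightarrow> complex"
  assumes sing: "singular_wrt_lebesgue \<mu>"
    and V: "finite V" "\<And>w. w \<in> V \<Longrightarrow> set w \<subseteq> {1..m}"
    and a_poly: "a = (\<Sum>w\<in>V. c w *\<^sub>C monomial w)"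
begin

text \<open>The trace theorem applied to \<open>T = R\<^sub>j z\<close>. Since \<open>z\<close> commutes with \<open>a\<close>, the commutator is
  \<open>[R\<^sub>j, Y] z = \<Sum> u P\<^sub>1 v z\<close>, and its trace against right multiplication by \<open>x\<close> is \<open>\<Sum> \<tau> (v z u x)\<close>. The
  case \<open>z = 1\<close> is the cyclic derivative of \<open>a\<close>, the case \<open>z = a\<close> is half that of \<open>a\<^sup>2\<close>.\<close>

lemma cyclic_derivative_zero:
  assumes j: "j \<in> {1..m}" and z: "z \<in> M" "z * a = a * z"
  shows "(\<Sum>w\<in>V. \<Sum>(u, v)\<in>occurrences j w. c w *\<^sub>C (monomial v * z * monomial u)) = 0"
proof -
  define S where "S = Sigma V (occurrences j)"
  have S: "finite S" unfolding S_def using V by auto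
  have uM: "monomial (fst (snd s)) \<in> M" "monomial (snd (snd s)) \<in> M" if "s \<in> S" for s
    using that V(2) occurrences_subset[of "fst (snd s)" "snd (snd s)"] unfolding S_def
    by (fastforce intro!: monomial_M)+
  define \<eta> where "\<eta> s = cnj (c (fst s)) *\<^sub>C \<Lambda> (cadjoint (monomial (snd (snd s)) * z))"
    for s :: "nat list \<times> nat list \<times> nat list"
  define \<alpha> where "\<alpha> s = monomial (fst (snd s))" for s :: "nat list \<times> nat list \<times> nat list"
  have \<eta>: "cinner (\<eta> s) \<zeta> = c (fst s) * cinner (\<Lambda> 1) (app (\<pi> (monomial (snd (snd s)))) (app (\<pi> z) \<zeta>))"
    if "s \<in> S" for s \<zeta>
  proof -
    have "cinner (\<Lambda> (cadjoint (monomial (snd (snd s)) * z))) \<zeta>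
        = cinner (app (\<pi> (cadjoint (monomial (snd (snd s)) * z))) (\<Lambda> 1)) \<zeta>"
      using uM[OF that] z by (simp add: \<pi>_\<Lambda>)
    then show ?thesis
      using uM[OF that] z by (simp add: \<eta>_def cinner_scaleC_left \<pi>_cadjoint \<pi>_mult)
  qed
  have comm: "app (R j * \<pi> z) (app (\<pi> a) \<zeta>) - app (\<pi> a) (app (R j * \<pi> z) \<zeta>)
      = (\<Sum>s\<in>S. cinner (\<eta> s) \<zeta> *\<^sub>C \<Lambda> (\<alpha> s))" for \<zeta>
  proof -
    have "app (\<pi> z) (app (\<pi> a) \<zeta>) = app (\<pi> a) (app (\<pi> z) \<zeta>)"
      using z by (metis \<pi>_mult a_M)
    then have "app (R j * \<pi> z) (app (\<pi> a) \<zeta>) - app (\<pi> a) (app (R j * \<pi> z) \<zeta>)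
        = app (R j) (app (\<pi> a) (app (\<pi> z) \<zeta>)) - app (\<pi> a) (app (R j) (app (\<pi> z) \<zeta>))"
      by (simp add: app_simps)
    also have "\<dots> = (\<Sum>w\<in>V. \<Sum>(u, v)\<in>occurrences j w.
        (c w * cinner (\<Lambda> 1) (app (\<pi> (monomial v)) (app (\<pi> z) \<zeta>))) *\<^sub>C \<Lambda> (monomial u))"
      by (rule commutator_polynomial[OF j V(2) a_poly])
    also have "\<dots> = (\<Sum>s\<in>S. cinner (\<eta> s) \<zeta> *\<^sub>C \<Lambda> (\<alpha> s))"
      using V(1) \<eta> by (simp add: S_def sum.Sigma split_def \<alpha>_def)
    finally show ?thesis .
  qed
  define D where "D = (\<Sum>s\<in>S. c (fst s) *\<^sub>C (monomial (snd (snd s)) * z * monomial (fst (snd s))))"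
  have "\<tau> (D * x) = 0" if x: "x \<in> M" for x
  proof -
    have "0 = (\<Sum>s\<in>S. cinner (\<eta> s) (\<Lambda> (\<alpha> s * x)))"
      by (rule trace_commutator_singular[OF sing S _ x comm, symmetric]) (simp add: \<alpha>_def uM)
    also have "\<dots> = (\<Sum>s\<in>S. c (fst s) * \<tau> (monomial (snd (snd s)) * z * monomial (fst (snd s)) * x))"
      using uM z x by (intro sum.cong refl) (simp add: \<eta> \<pi>_\<Lambda> cinner_\<Lambda> \<alpha>_def mult.assoc)
    also have "\<dots> = \<tau> (D * x)"
      using uM z x by (simp add: D_def sum_distrib_right cop_scaleC_mult_left \<tau>_sum \<tau>_scaleC)
    finally show ?thesis by simp
  qed
  moreover have "D \<in> M" unfolding D_def using uM z by simp
  ultimately have "D = 0" by (intro \<tau>_nondegenerate)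
  then show ?thesis
    using V(1) by (simp add: D_def S_def sum.Sigma split_def)
qed

text \<open>Written as a sum so that it is \<open>0\<close> when \<open>V\<close> does not contain the empty word.\<close>

definition constant_term :: complex where
  "constant_term = (\<Sum>w\<in>{w \<in> V. w = []}. c w)"

lemma \<tau>_a: "\<tau> a = constant_term"
proof -
  have "\<tau> (\<Sum>w\<in>V. c w *\<^sub>C monomial w) = (\<Sum>w\<in>{w \<in> V. w = []}. c w)"
    by (rule trace_of_cyclic_derivative_zero[where w = "\<lambda>w. w"])
       (use V cyclic_derivative_zero[of _ 1] in simp_all)
  then show ?thesis by (simp add: constant_term_def a_poly)
qed

text \<open>Here \<open>a\<^sup>2\<close> is the family of the words \<open>w w'\<close> indexed by the pairs \<open>(w, w')\<close>. By the Leibniz rule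
  its cyclic derivative has the terms \<open>v w' u\<close> with \<open>w = u j v\<close> and the terms \<open>v w u\<close> with
  \<open>w' = u j v\<close>; after exchanging \<open>w\<close> and \<open>w'\<close> both add up to the expression that
  \<open>cyclic_derivative_zero\<close> shows to vanish for \<open>z = a\<close>.\<close>

lemma \<tau>_a_square: "\<tau> (a * a) = constant_term * constant_term"
proof -
  let ?C = "\<lambda>p. c (fst p) * c (snd p)"
  have sq: "a * a = (\<Sum>p\<in>V \<times> V. ?C p *\<^sub>C monomial (fst p @ snd p))"
    unfolding a_poly sum_product sum.cartesian_product
    by (simp add: split_def cop_scaleC_mult_left cop_scaleC_mult_right scaleC_scaleC mult.commute)
  have "\<tau> (a * a) = (\<Sum>p\<in>{p \<in> V \<times> V. fst p @ snd p = []}. ?C p)"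
    unfolding sq
  proof (rule trace_of_cyclic_derivative_zero)
    fix j assume j: "j \<in> {1..m}"
    have zero: "(\<Sum>w\<in>V. \<Sum>(u, v)\<in>occurrences j w. c w *\<^sub>C (monomial v * a * monomial u)) = 0"
      by (rule cyclic_derivative_zero[OF j]) simp_all
    have eq: "c w *\<^sub>C (monomial v * a * monomial u)
        = (\<Sum>w'\<in>V. (c w * c w') *\<^sub>C monomial (v @ w' @ u))" for w u v
      by (simp add: a_poly sum_distrib_left sum_distrib_right complex_vector.scale_sum_right
          cop_scaleC_mult_left cop_scaleC_mult_right scaleC_scaleC mult.assoc)
    \<comment> \<open>The sum \<open>zero\<close> with its middle factor \<open>a\<close> expanded into words \<open>w'\<close>.\<close>
    have zero': "(\<Sum>w\<in>V. \<Sum>w'\<in>V. \<Sum>(u, v)\<in>occurrences j w. (c w * c w') *\<^sub>C monomial (v @ w' @ u)) = 0"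
    proof -
      have "(\<Sum>w'\<in>V. \<Sum>(u, v)\<in>occurrences j w. (c w * c w') *\<^sub>C monomial (v @ w' @ u))
          = (\<Sum>(u, v)\<in>occurrences j w. c w *\<^sub>C (monomial v * a * monomial u))" for w
        unfolding eq split_def by (rule sum.swap)
      then show ?thesis using zero by simp
    qed
    have "(\<Sum>p\<in>V \<times> V. \<Sum>(u, v)\<in>occurrences j (fst p @ snd p). ?C p *\<^sub>C monomial (v @ u))
        = (\<Sum>w\<in>V. \<Sum>w'\<in>V. \<Sum>(u, v)\<in>occurrences j (w @ w'). (c w * c w') *\<^sub>C monomial (v @ u))"
      by (simp add: sum.cartesian_product split_def)
    also have "\<dots> = (\<Sum>w\<in>V. \<Sum>w'\<in>V. \<Sum>(u, v)\<in>occurrences j w. (c w * c w') *\<^sub>C monomial (v @ w' @ u))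
        + (\<Sum>w\<in>V. \<Sum>w'\<in>V. \<Sum>(u, v)\<in>occurrences j w'. (c w' * c w) *\<^sub>C monomial (v @ w @ u))"
      by (simp add: sum_occurrences_append sum.distrib mult.commute mult.assoc)
    also have "\<dots> = 0"
      by (subst (2) sum.swap) (simp only: zero' add_0)
    finally show "(\<Sum>p\<in>V \<times> V. \<Sum>(u, v)\<in>occurrences j (fst p @ snd p). ?C p *\<^sub>C monomial (v @ u)) = 0" .
  next
    show "set (fst p @ snd p) \<subseteq> {1..m}" if "p \<in> V \<times> V" for p
      unfolding set_append by (intro Un_least V(2)) (use that in auto)
  qed (use V(1) in simp)
  also have "{p \<in> V \<times> V. fst p @ snd p = []} = {w \<in> V. w = []} \<times> {w \<in> V. w = []}" by auto
  also have "(\<Sum>p\<in>\<dots>. ?C p) = constant_term * constant_term"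
    unfolding constant_term_def sum_product sum.cartesian_product by (simp add: split_def)
  finally show ?thesis .
qed

text \<open>The element \<open>a\<close> has variance \<open>\<tau> (a\<^sup>2) - \<tau> (a)\<^sup>2 = 0\<close>.\<close>

lemma a_constant: "a = constant_term *\<^sub>C 1"
proof -
  have real: "cnj constant_term = constant_term"
    using \<tau>_cadjoint[OF a_M] by (simp add: a_selfadjoint \<tau>_a)
  define b where "b = a - constant_term *\<^sub>C 1"
  have ab: "a = b + constant_term *\<^sub>C 1" by (simp add: b_def)
  have "cadjoint a = cadjoint b + constant_term *\<^sub>C 1"
    by (subst ab) (simp add: cadjoint_add cadjoint_scaleC real)
  then have "cadjoint b = b" using ab a_selfadjoint by (metis add_right_cancel)
  then have "cadjoint b * b = b * b" by simp
  also have "\<dots> = a * a - constant_term *\<^sub>C a - constant_term *\<^sub>C a + (constant_term * constant_term) *\<^sub>C 1"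
    by (simp add: b_def algebra_simps cop_scaleC_mult_left cop_scaleC_mult_right scaleC_scaleC)
  finally have "\<tau> (cadjoint b * b) = 0"
    by (simp add: \<tau>_add \<tau>_diff \<tau>_scaleC \<tau>_a \<tau>_a_square \<tau>_one)
  then have "b = 0" by (intro \<tau>_faithful) (simp_all add: b_def)
  then show ?thesis by (simp add: b_def)
qed

lemma coefficient_zero:
  assumes w: "w \<in> V" "w \<noteq> []"
  shows "c w = 0"
proof -
  have "a = (\<Sum>w\<in>V - {[]}. c w *\<^sub>C monomial w) + (\<Sum>w\<in>{w \<in> V. w = []}. c w *\<^sub>C monomial w)"
    unfolding a_poly by (subst sum.union_disjoint[symmetric]) (use V(1) in \<open>auto intro!: sum.cong\<close>)
  also have "(\<Sum>w\<in>{w \<in> V. w = []}. c w *\<^sub>C monomial w) = constant_term *\<^sub>C 1"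
    unfolding constant_term_def complex_vector.scale_sum_left by (intro sum.cong) auto
  finally have "(\<Sum>w\<in>V - {[]}. c w *\<^sub>C monomial w) = 0"
    using a_constant by simp
  then have "(\<Sum>v\<in>V - {[]}. c v * (if v = w then 1 else 0)) = 0"
    using V by (intro monomials_free) auto
  also have "(\<Sum>v\<in>V - {[]}. c v * (if v = w then 1 else 0))
      = (\<Sum>v\<in>V - {[]}. if v = w then c v else 0)"
    by (intro sum.cong) auto
  also have "\<dots> = c w" using V(1) w by simp
  finally show ?thesis .
qed

end

theorem theorem11:
  fixes n m :: nat
    and M :: "'k::chilbert_space cop set" and \<tau> :: "'k cop \<Rightarrow> complex"
    and y :: "nat \<Rightarrow> 'k cop" and a :: "'k cop" and p :: nc_poly
    and \<Lambda> :: "'k cop \<Rightarrow> 'h::chilbert_space" and \<pi> :: "'k cop \<Rightarrow> 'h cop"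
    and P\<^sub>1 :: "'h cop" and \<mu> :: "real measure"
  assumes "1 \<le> n" and "n \<le> m"
    and "tracial_von_neumann_algebra M \<tau>"
    and "\<And>j. j \<in> {1..m} \<Longrightarrow> selfadjoint (y j)"
    and "M = W_star (y ` {1..m})"
    and "L2_space M \<tau> \<Lambda>" and "left_multiplication M \<Lambda> \<pi>"
    and "selfadjoint a" and "a \<in> Alg (y ` {1..n})"
    and "nc_poly_in n p" and "nc_nonconstant p" and "a = nc_eval p y"
    and "orthogonal_projection_onto P\<^sub>1 (range (\<lambda>c. c *\<^sub>C \<Lambda> 1))"
    and "\<exists>R. dual_system m (\<lambda>k. \<pi> (y k)) P\<^sub>1 R"
    and "is_spectral_measure \<tau> a \<mu>"
  shows "\<not> singular_wrt_lebesgue \<mu>"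
proof
  assume sing: "singular_wrt_lebesgue \<mu>"
  obtain R where dual: "dual_system m (\<lambda>k. \<pi> (y k)) P\<^sub>1 R" using assms by blast
  interpret dual_system_L2 M \<tau> \<Lambda> \<pi> m y P\<^sub>1 R
  proof unfold_locales
    show "y j \<in> M" if "j \<in> {1..m}" for j
      using generators_in_W_star[of "y ` {1..m}"] assms(5) that by auto
  qed (use assms dual in auto)
  define V where "V = Poly_Mapping.keys p"
  have V: "finite V" "set w \<subseteq> {1..m}" if "w \<in> V" for w
    using assms(2,10) that unfolding V_def nc_poly_in_def by fastforce+
  have finV: "finite V" by (simp add: V_def)
  have a_poly: "a = (\<Sum>w\<in>V. Poly_Mapping.lookup p w *\<^sub>C monomial w)"
    using assms(12) by (simp add: nc_eval_def V_def monomial_def)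
  have sets: "sets \<mu> = sets borel" and mass: "emeasure \<mu> (space \<mu>) = 1"
    using assms(15) unfolding is_spectral_measure_def by auto
  obtain K where K: "compact K" "emeasure \<mu> (- K) = 0"
    using assms(15) unfolding is_spectral_measure_def by auto
  obtain r where r: "\<And>t. t \<in> K \<Longrightarrow> t \<in> {-r..r}"
    using compact_imp_bounded[OF K(1)] by (force simp: bounded_iff abs_le_iff)
  interpret finite_measure \<mu> by (rule finite_measureI) (simp add: mass)
  interpret dual_system_singular M \<tau> \<Lambda> \<pi> m y P\<^sub>1 R \<mu> a r V "Poly_Mapping.lookup p"
  proof unfold_locales
    show "a \<in> M" unfolding a_poly using V by auto
    show "cadjoint a = a" using assms(8) by (simp add: selfadjoint_def)
    show "AE t in \<mu>. t \<in> {-r..r}"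
    proof (rule AE_I)
      show "{t \<in> space \<mu>. t \<notin> {-r..r}} \<subseteq> - K" using r by auto
      show "- K \<in> sets \<mu>" unfolding sets by (rule borel_comp) (rule borel_compact[OF K(1)])
    qed (rule K(2))
    show "complex_of_real (\<integral>t. t ^ k \<partial>\<mu>) = \<tau> (a ^ k)" for k
      using assms(15) unfolding is_spectral_measure_def by auto
  qed (use sets sing finV V a_poly in auto)
  obtain w where w: "w \<in> V" "w \<noteq> []"
    using assms(11) unfolding nc_nonconstant_def V_def by auto
  have "Poly_Mapping.lookup p w = 0" by (rule coefficient_zero[OF w])
  then show False using w(1) by (simp add: V_def Poly_Mapping.in_keys_iff)
qed

end
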